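(* For (not necessarily symmetric) additively separable hedonic games with integer valuations whose underlying undirected graph is a tree on $n$ vertices, Max Egalitarian (find a partition maximizing the minimum utility of an agent) can be solved in time $O(n\log W)$, where $W=\max_{u\in V}\sum_{v\in N(u)}|w_{uv}|$.
   Context: An additively separable hedonic game is given by a directed edge-weighted graph $G=(V,E,w)$ whose vertices are agents; $w_{uv}$ is the valuation of $u$ for $v$ (absent edges mean valuation $0$), and the underlying graph is obtained by ignoring directions. For a partition $\mathcal{P}$ of $V$ into coalitions, with $C_u$ the coalition containing $u$, the utility of $u$ is $\sum_{v\in N(u)\cap C_u} w_{uv}$. *)

theory Defs
  imports Complex_Main
begin

text \<open>A game on agents 0,...,n-1 is given by a list of edges of the underlying
undirected graph; an entry (u, v, a, b) means w_uv = a and w_vu = b.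
(A directed edge in only one direction is encoded with the other weight 0.)\<close>

type_synonym edge = "nat \<times> nat \<times> int \<times> int"

definition wt :: "edge list \<Rightarrow> nat \<Rightarrow> nat \<Rightarrow> int" where
  "wt es u v = sum_list (map (\<lambda>(x, y, a, b).
      (if x = u \<and> y = v then a else 0) + (if x = v \<and> y = u then b else 0)) es)"

definition nbrs :: "edge list \<Rightarrow> nat \<Rightarrow> nat set" where
  "nbrs es u = {v. \<exists>a b. (u, v, a, b) \<in> set es \<or> (v, u, a, b) \<in> set es}"

definition adj :: "edge list \<Rightarrow> nat \<Rightarrow> nat \<Rightarrow> bool" where
  "adj es u v \<longleftrightarrow> v \<in> nbrs es u"

text \<open>Underlying graph is a tree on vertex set {0..<n}: n >= 1, exactly n-1 edges,
no loops, all endpoints are vertices, and the graph is connected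
(connected with n-1 edges on n vertices is equivalent to being a tree).\<close>
definition is_tree_game :: "nat \<Rightarrow> edge list \<Rightarrow> bool" where
  "is_tree_game n es \<longleftrightarrow> n \<ge> 1 \<and> length es = n - 1
     \<and> (\<forall>(u, v, a, b) \<in> set es. u < n \<and> v < n \<and> u \<noteq> v)
     \<and> (\<forall>v < n. (adj es)\<^sup>*\<^sup>* 0 v)"

text \<open>A partition of {0..<n} is represented by a labelling p; the coalition
of u consists of the agents with the same label.\<close>
definition coalition :: "nat \<Rightarrow> (nat \<Rightarrow> int) \<Rightarrow> nat \<Rightarrow> nat set" where
  "coalition n p u = {v. v < n \<and> p v = p u}"

definition utility :: "nat \<Rightarrow> edge list \<Rightarrow> (nat \<Rightarrow> int) \<Rightarrow> nat \<Rightarrow> int" where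
  "utility n es p u = (\<Sum>v \<in> nbrs es u \<inter> coalition n p u. wt es u v)"

definition egal_welfare :: "nat \<Rightarrow> edge list \<Rightarrow> (nat \<Rightarrow> int) \<Rightarrow> int" where
  "egal_welfare n es p = Min (utility n es p ` {0..<n})"

definition max_egalitarian :: "nat \<Rightarrow> edge list \<Rightarrow> (nat \<Rightarrow> int) \<Rightarrow> bool" where
  "max_egalitarian n es p \<longleftrightarrow>
     (\<forall>q. egal_welfare n es q \<le> egal_welfare n es p)"

definition Wmax :: "nat \<Rightarrow> edge list \<Rightarrow> int" where
  "Wmax n es = Max ((\<lambda>u. \<Sum>v \<in> nbrs es u. \<bar>wt es u v\<bar>) ` {0..<n})"

text \<open>Memory cells indexed by nat hold integers. Each executed instruction
costs one time unit. Arithmetic: addition, subtraction, halving (no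
multiplication, to avoid unit-cost abuse). Indirect load/store.\<close>

datatype instr =
    Const nat int
  | Add nat nat nat
  | Sub nat nat nat
  | Half nat nat
  | Load nat nat
  | Store nat nat
  | Jpos nat nat
  | Jmp nat
  | Halt

type_synonym state = "nat \<times> (nat \<Rightarrow> int)"

definition halted :: "instr list \<Rightarrow> state \<Rightarrow> bool" where
  "halted P s \<longleftrightarrow> fst s \<ge> length P \<or> P ! fst s = Halt"

fun exec1 :: "instr \<Rightarrow> state \<Rightarrow> state" where
  "exec1 (Const r c) (pc, M) = (Suc pc, M(r := c))"
| "exec1 (Add r a b) (pc, M) = (Suc pc, M(r := M a + M b))"
| "exec1 (Sub r a b) (pc, M) = (Suc pc, M(r := M a - M b))"
| "exec1 (Half r a) (pc, M) = (Suc pc, M(r := M a div 2))"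
| "exec1 (Load r a) (pc, M) = (Suc pc, M(r := M (nat (M a))))"
| "exec1 (Store r a) (pc, M) = (Suc pc, M(nat (M a) := M r))"
| "exec1 (Jpos r t) (pc, M) = (if M r > 0 then t else Suc pc, M)"
| "exec1 (Jmp t) (pc, M) = (t, M)"
| "exec1 Halt (pc, M) = (pc, M)"

definition step :: "instr list \<Rightarrow> state \<Rightarrow> state" where
  "step P s = (if halted P s then s else exec1 (P ! fst s) s)"

definition run :: "instr list \<Rightarrow> nat \<Rightarrow> state \<Rightarrow> state" where
  "run P k s = (step P ^^ k) s"

text \<open>Input encoding: M[0] = n, and edge i = (u, v, a, b) is stored in
M[4i+1], M[4i+2], M[4i+3], M[4i+4]; all other cells are 0.\<close>
definition input_mem :: "nat \<Rightarrow> edge list \<Rightarrow> nat \<Rightarrow> int" where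
  "input_mem n es j =
     (if j = 0 then int n
      else if j \<le> 4 * length es then
        (case es ! ((j - 1) div 4) of (u, v, a, b) \<Rightarrow>
           [int u, int v, a, b] ! ((j - 1) mod 4))
      else 0)"

text \<open>Output encoding: after halting, M[j] for j < n is the coalition label
of agent j.\<close>

end

theory Submission
  imports Defs
begin

text \<open>
  Cutting or keeping the edges of a tree can be decided independently, so a partition amounts to a set
  of kept edges, and the utility of an agent is the sum of its valuations along kept edges. Whether
  every agent can reach utility \<open>t\<close> is decided greedily from the leaves: if \<open>v\<close> is a leaf with
  neighbour \<open>p\<close> and \<open>s\<close> is the utility that \<open>v\<close> has already collected, the edge is kept iff
  \<open>s + w\<^sub>v\<^sub>p \<ge> t\<close> and (\<open>w\<^sub>p\<^sub>v > 0\<close> or \<open>s < t\<close>). The optimum lies in \<open>{0, ..., W}\<close>, so doubling followed by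
  bisection finds it with \<open>O(log W)\<close> linear-time tests.

  The leaf order is computed in linear time without adjacency lists: for every vertex the machine
  stores its degree, the sum of its neighbours and the sums of its outgoing and incoming
  valuations in the remaining tree. At a vertex of degree 1 these sums are the missing data of its
  only edge, and removing a leaf updates them by subtraction.
\<close>

section \<open>A structured language on the machine\<close>

text \<open>The bound counts single machine instructions, and the machine shapes the proof. Input
  and output occupy the lowest cells, exactly where fixed registers have to live, so the data are
  moved to a region starting at \<open>64 * n\<close> before the computation and back afterwards. As
  there is no multiplication, every address is produced by doublings. Linear time forbids searching
  for each leaf anew. Removing a leaf can create a new leaf only at its neighbour, so the neighbour
  is examined next, and a pointer that only moves down supplies another vertex when the neighbour is
  no leaf. The range of the search comes from the partition into singletons, where every utility is
  0, and from any single agent, whose utility never exceeds W. As utilities are integers,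
  \<open>t\<close> is optimal as soon as it is feasible and \<open>t + 1\<close> is not.\<close>

type_synonym memory = "nat \<Rightarrow> int"

lemma run_0: "run P 0 s = s"
  by (simp add: run_def)

lemma run_Suc: "run P (Suc k) s = run P k (step P s)"
  by (simp add: run_def funpow_swap1)

lemma run_add: "run P (j + k) s = run P k (run P j s)"
  unfolding run_def by (metis add.commute comp_apply funpow_add)

lemma run_trans: "run P j s = s' \<Longrightarrow> run P k s' = s'' \<Longrightarrow> run P (j + k) s = s''"
  by (simp add: run_add)

definition code_at :: "instr list \<Rightarrow> nat \<Rightarrow> instr list \<Rightarrow> bool" where
  "code_at P pc is \<longleftrightarrow> (\<forall>i < length is. pc + i < length P \<and> P ! (pc + i) = is ! i)"

lemma code_at_Nil [simp]: "code_at P pc []"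
  by (simp add: code_at_def)

lemma code_at_Cons [simp]:
  "code_at P pc (i # is) \<longleftrightarrow> pc < length P \<and> P ! pc = i \<and> code_at P (Suc pc) is"
  by (auto simp: code_at_def nth_Cons less_Suc_eq_0_disj split: nat.splits)

lemma code_at_append [simp]:
  "code_at P pc (xs @ ys) \<longleftrightarrow> code_at P pc xs \<and> code_at P (pc + length xs) ys"
  by (induction xs arbitrary: pc) auto

lemma code_at_self: "code_at (xs @ ys @ zs) (length xs) ys"
  by (simp add: code_at_def nth_append)

lemma step_exec1: "pc < length P \<Longrightarrow> P ! pc = i \<Longrightarrow> i \<noteq> Halt \<Longrightarrow> step P (pc, M) = exec1 i (pc, M)"
  by (simp add: step_def halted_def)

fun straight :: "instr \<Rightarrow> bool" where
  "straight (Jpos r t) = False"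
| "straight (Jmp t) = False"
| "straight Halt = False"
| "straight _ = True"

definition exec_mem :: "instr \<Rightarrow> memory \<Rightarrow> memory" where
  "exec_mem i M = snd (exec1 i (0, M))"

lemma exec_mem_simps [simp]:
  "exec_mem (Const r c) M = M(r := c)"
  "exec_mem (Add r a b) M = M(r := M a + M b)"
  "exec_mem (Sub r a b) M = M(r := M a - M b)"
  "exec_mem (Half r a) M = M(r := M a div 2)"
  "exec_mem (Load r a) M = M(r := M (nat (M a)))"
  "exec_mem (Store r a) M = M(nat (M a) := M r)"
  by (simp_all add: exec_mem_def)

lemma run_straight:
  "code_at P pc is \<Longrightarrow> \<forall>i \<in> set is. straight i \<Longrightarrow>
   run P (length is) (pc, M) = (pc + length is, fold exec_mem is M)"
proof (induction "is" arbitrary: pc M)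
  case Nil
  then show ?case by (simp add: run_0)
next
  case (Cons i "is")
  have "exec1 i (pc, M) = (Suc pc, exec_mem i M)" "i \<noteq> Halt"
    using Cons.prems by (cases i; simp)+
  then show ?case using Cons by (simp add: run_Suc step_exec1)
qed

section \<open>Structured commands, their cost semantics and their compilation\<close>

type_synonym astate = "(nat \<Rightarrow> int) \<times> (nat \<Rightarrow> nat \<Rightarrow> int)"

definition put :: "nat \<Rightarrow> nat \<Rightarrow> int \<Rightarrow> (nat \<Rightarrow> nat \<Rightarrow> int) \<Rightarrow> nat \<Rightarrow> nat \<Rightarrow> int" where
  "put a i d A = A(a := (A a)(i := d))"

lemma put_apply [simp]: "put a i d A c j = (if c = a \<and> j = i then d else A c j)"
  by (simp add: put_def)

definition incr :: "nat \<Rightarrow> nat \<Rightarrow> int \<Rightarrow> (nat \<Rightarrow> nat \<Rightarrow> int) \<Rightarrow> nat \<Rightarrow> nat \<Rightarrow> int" where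
  "incr a i d A = A(a := (A a)(i := A a i + d))"

lemma incr_apply [simp]: "incr a i d A c j = (if c = a \<and> j = i then A c j + d else A c j)"
  by (simp add: incr_def)

lemma incr_put: "incr a i d A = put a i (A a i + d) A"
  by (simp add: incr_def put_def)

datatype com =
    SetC nat int
  | AddR nat nat nat
  | SubR nat nat nat
  | HalfR nat nat
  | ALd nat nat nat
  | ASt nat nat nat
  | AInc nat nat nat
  | Seq com com  (infixr ";;" 60)
  | IfP nat com com
  | WhileP nat com

text \<open>The cost counts executed commands and guard evaluations. Array commands are stuck on a
  negative index: there \<open>nat\<close> would yield entry 0, whereas the machine would compute an
  address below that of entry 0.\<close>

inductive bs :: "com \<Rightarrow> astate \<Rightarrow> nat \<Rightarrow> astate \<Rightarrow> bool" where
  SetC: "bs (SetC r c) (R, A) 1 (R(r := c), A)"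
| AddR: "bs (AddR r x y) (R, A) 1 (R(r := R x + R y), A)"
| SubR: "bs (SubR r x y) (R, A) 1 (R(r := R x - R y), A)"
| HalfR: "bs (HalfR r x) (R, A) 1 (R(r := R x div 2), A)"
| ALd: "R x \<ge> 0 \<Longrightarrow> bs (ALd r a x) (R, A) 1 (R(r := A a (nat (R x))), A)"
| ASt: "R x \<ge> 0 \<Longrightarrow> bs (ASt a x r) (R, A) 1 (R, put a (nat (R x)) (R r) A)"
| AInc: "R x \<ge> 0 \<Longrightarrow>
    bs (AInc a x r) (R, A) 1 (R, incr a (nat (R x)) (R r) A)"
| Seq: "bs c1 s j s' \<Longrightarrow> bs c2 s' k s'' \<Longrightarrow> bs (c1 ;; c2) s (j + k) s''"
| IfT: "fst s r > 0 \<Longrightarrow> bs c1 s k s' \<Longrightarrow> bs (IfP r c1 c2) s (Suc k) s'"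
| IfF: "\<not> fst s r > 0 \<Longrightarrow> bs c2 s k s' \<Longrightarrow> bs (IfP r c1 c2) s (Suc k) s'"
| WhileF: "\<not> fst s r > 0 \<Longrightarrow> bs (WhileP r c) s 1 s"
| WhileT: "fst s r > 0 \<Longrightarrow> bs c s j s' \<Longrightarrow> bs (WhileP r c) s' k s'' \<Longrightarrow>
    bs (WhileP r c) s (Suc (j + k)) s''"

text \<open>Cell 60 holds the base address \<open>64 * n\<close> and cells 61 and 62 are scratch space, so programs
  may use the registers below 60 and the arrays 0, ..., 15. Entry \<open>i\<close> of array \<open>a\<close> lives at address
  \<open>64 * n + 16 * i + a\<close>.\<close>

fun wf_com :: "com \<Rightarrow> bool" where
  "wf_com (SetC r c) = (r < 60)"
| "wf_com (AddR r x y) = (r < 60 \<and> x < 60 \<and> y < 60)"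
| "wf_com (SubR r x y) = (r < 60 \<and> x < 60 \<and> y < 60)"
| "wf_com (HalfR r x) = (r < 60 \<and> x < 60)"
| "wf_com (ALd r a x) = (r < 60 \<and> a < 16 \<and> x < 60)"
| "wf_com (ASt a x r) = (r < 60 \<and> a < 16 \<and> x < 60)"
| "wf_com (AInc a x r) = (r < 60 \<and> a < 16 \<and> x < 60)"
| "wf_com (c1 ;; c2) = (wf_com c1 \<and> wf_com c2)"
| "wf_com (IfP r c1 c2) = (r < 60 \<and> wf_com c1 \<and> wf_com c2)"
| "wf_com (WhileP r c) = (r < 60 \<and> wf_com c)"

definition rep :: "nat \<Rightarrow> memory \<Rightarrow> astate \<Rightarrow> bool" where
  "rep n M s \<longleftrightarrow> (\<forall>r < 60. M r = fst s r) \<and> M 60 = 64 * int n \<and>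
     (\<forall>a < 16. \<forall>i. M (64 * n + 16 * i + a) = snd s a i)"

text \<open>Four doublings stand in for the product by the stride 16.\<close>

definition addr_code :: "nat \<Rightarrow> nat \<Rightarrow> instr list" where
  "addr_code a x = [Add 61 x x, Add 61 61 61, Add 61 61 61, Add 61 61 61, Add 61 61 60,
     Const 62 (int a), Add 61 61 62]"

fun csize :: "com \<Rightarrow> nat" where
  "csize (SetC r c) = 1"
| "csize (AddR r x y) = 1"
| "csize (SubR r x y) = 1"
| "csize (HalfR r x) = 1"
| "csize (ALd r a x) = 8"
| "csize (ASt a x r) = 8"
| "csize (AInc a x r) = 10"
| "csize (c1 ;; c2) = csize c1 + csize c2"
| "csize (IfP r c1 c2) = 2 + csize c2 + csize c1"
| "csize (WhileP r c) = 3 + csize c"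

fun comp :: "nat \<Rightarrow> com \<Rightarrow> instr list" where
  "comp pc (SetC r c) = [Const r c]"
| "comp pc (AddR r x y) = [Add r x y]"
| "comp pc (SubR r x y) = [Sub r x y]"
| "comp pc (HalfR r x) = [Half r x]"
| "comp pc (ALd r a x) = addr_code a x @ [Load r 61]"
| "comp pc (ASt a x r) = addr_code a x @ [Store r 61]"
| "comp pc (AInc a x r) = addr_code a x @ [Load 62 61, Add 62 62 r, Store 62 61]"
| "comp pc (c1 ;; c2) = comp pc c1 @ comp (pc + csize c1) c2"
| "comp pc (IfP r c1 c2) = Jpos r (pc + 2 + csize c2) # comp (Suc pc) c2 @
     Jmp (pc + 2 + csize c2 + csize c1) # comp (pc + 2 + csize c2) c1"
| "comp pc (WhileP r c) = Jpos r (pc + 2) # Jmp (pc + 3 + csize c) # comp (pc + 2) c @ [Jmp pc]"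

lemma length_comp [simp]: "length (comp pc c) = csize c"
  by (induction c arbitrary: pc) (auto simp: addr_code_def)

lemma run_addr_code:
  assumes "rep n M (R, A)" "R x \<ge> 0" "x < 60"
  shows "\<exists>u v. fold exec_mem (addr_code a x) M =
    M(62 := u, 61 := int (64 * n + 16 * nat (R x) + a))"
proof -
  have "M x = R x" "M 60 = 64 * int n" using assms by (auto simp: rep_def)
  then show ?thesis using assms
    by (intro exI[of _ "int a"]) (auto simp: addr_code_def fun_eq_iff)
qed

lemma rep_reg: "rep n M (R, A) \<Longrightarrow> r < 60 \<Longrightarrow> M r = R r"
  by (simp add: rep_def)

lemma rep_upd_reg:
  assumes "rep n M (R, A)" "n \<ge> 1" "r < 60"
  shows "rep n (M(r := v)) (R(r := v), A)"
  using assms by (auto simp: rep_def)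

lemma rep_upd_scratch:
  assumes "rep n M s" "n \<ge> 1" "r = 61 \<or> r = 62"
  shows "rep n (M(r := v)) s"
  using assms by (auto simp: rep_def)

text \<open>The residue modulo 16 reveals the array, so sixteen interleaved arrays never collide
  although their lengths are unbounded.\<close>

lemma address_inject:
  assumes "64 * n + 16 * i + a = 64 * n + 16 * j + b" "a < 16" "b < (16::nat)"
  shows "i = j \<and> a = b"
proof -
  have "(16 * i + a) mod 16 = (16 * j + b) mod 16" using assms by simp
  then have "a = b" using assms by simp
  then show ?thesis using assms by simp
qed

lemma rep_upd_array:
  assumes "rep n M (R, A)" "n \<ge> 1" "a < 16"
  shows "rep n (M(64 * n + 16 * i + a := v)) (R, put a i v A)"
  using assms address_inject[of n _ _ i a] by (auto simp: rep_def simp del: add_left_cancel)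

lemma run_straight_rep:
  assumes "code_at P pc is" "\<forall>i \<in> set is. straight i" "rep n (fold exec_mem is M) s"
    "length is \<le> 11"
  shows "\<exists>j M'. j \<le> 11 * 1 \<and> run P j (pc, M) = (pc + length is, M') \<and> rep n M' s"
  using run_straight[OF assms(1,2)] assms(3,4) by fastforce

text \<open>The factor 11 covers the most expensive command: seven instructions for an address and
  up to three for the access. A guard evaluation adds at most two jumps. \<open>M\<close> and
  \<open>pc\<close> stay arbitrary because a loop is re-entered at the same \<open>pc\<close> with a
  new memory.\<close>

lemma comp_correct:
  assumes "bs c s k s'"
  shows "wf_com c \<Longrightarrow> n \<ge> 1 \<Longrightarrow> rep n M s \<Longrightarrow> code_at P pc (comp pc c) \<Longrightarrow>
    \<exists>j M'. j \<le> 11 * k \<and> run P j (pc, M) = (pc + csize c, M') \<and> rep n M' s'"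
  using assms
proof (induction arbitrary: M pc rule: bs.induct)
  case (SetC r c R A)
  then show ?case
    by (intro exI[of _ 1] exI[of _ "M(r := c)"])
       (simp add: run_Suc run_0 step_exec1 rep_upd_reg del: fun_upd_apply)
next
  case (AddR r x y R A)
  then show ?case
    by (intro exI[of _ 1] exI[of _ "M(r := R x + R y)"])
       (auto simp: run_Suc run_0 step_exec1 rep_upd_reg rep_reg simp del: fun_upd_apply)
next
  case (SubR r x y R A)
  then show ?case
    by (intro exI[of _ 1] exI[of _ "M(r := R x - R y)"])
       (auto simp: run_Suc run_0 step_exec1 rep_upd_reg rep_reg simp del: fun_upd_apply)
next
  case (HalfR r x R A)
  then show ?case
    by (intro exI[of _ 1] exI[of _ "M(r := R x div 2)"])
       (auto simp: run_Suc run_0 step_exec1 rep_upd_reg rep_reg simp del: fun_upd_apply)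
next
  case (ALd R x r a A)
  define d where "d = 64 * n + 16 * nat (R x) + a"
  obtain u where u: "fold exec_mem (addr_code a x) M = M(62 := u, 61 := int d)"
    using run_addr_code ALd unfolding d_def by (metis wf_com.simps(5))
  have d: "d \<ge> 64" "M d = A a (nat (R x))"
    using ALd by (auto simp: rep_def d_def)
  then have "fold exec_mem (comp pc (ALd r a x)) M =
      (M(62 := u, 61 := int d))(r := A a (nat (R x)))"
    using u ALd by simp
  moreover have "rep n \<dots> (R(r := A a (nat (R x))), A)"
    using ALd by (intro rep_upd_reg[OF rep_upd_scratch[OF rep_upd_scratch]]) auto
  moreover have "\<forall>i \<in> set (comp pc (ALd r a x)). straight i"
    by (simp add: addr_code_def)
  ultimately show ?case
    using run_straight_rep[OF ALd(5)] by (simp only: length_comp) simp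
next
  case (ASt R x a r A)
  define d where "d = 64 * n + 16 * nat (R x) + a"
  obtain u where u: "fold exec_mem (addr_code a x) M = M(62 := u, 61 := int d)"
    using run_addr_code ASt unfolding d_def by (metis wf_com.simps(6))
  have d: "d \<ge> 64" using ASt by (auto simp: d_def)
  have "fold exec_mem (comp pc (ASt a x r)) M = (M(62 := u, 61 := int d))(d := R r)"
    using u ASt d by (simp add: rep_reg)
  moreover have "rep n \<dots> (R, put a (nat (R x)) (R r) A)"
    unfolding d_def using ASt by (intro rep_upd_array rep_upd_scratch) auto
  moreover have "\<forall>i \<in> set (comp pc (ASt a x r)). straight i"
    by (simp add: addr_code_def)
  ultimately show ?case
    using run_straight_rep[OF ASt(5)] by (simp only: length_comp) simp
next
  case (AInc R x a r A)
  define d where "d = 64 * n + 16 * nat (R x) + a"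
  let ?v = "A a (nat (R x)) + R r"
  obtain u where u: "fold exec_mem (addr_code a x) M = M(62 := u, 61 := int d)"
    using run_addr_code AInc unfolding d_def by (metis wf_com.simps(7))
  have d: "d \<ge> 64" "M d = A a (nat (R x))"
    using AInc by (auto simp: rep_def d_def)
  then have "fold exec_mem (comp pc (AInc a x r)) M =
      (M(62 := u, 61 := int d, 62 := A a (nat (R x)), 62 := ?v))(d := ?v)"
    using u AInc by (simp add: rep_reg)
  moreover have "rep n \<dots> (R, incr a (nat (R x)) (R r) A)"
    unfolding d_def incr_put using AInc by (intro rep_upd_array rep_upd_scratch) auto
  moreover have "\<forall>i \<in> set (comp pc (AInc a x r)). straight i"
    by (simp add: addr_code_def)
  ultimately show ?case
    using run_straight_rep[OF AInc(5)] by (simp only: length_comp) simp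
next
  case (Seq c1 s j s' c2 k s'')
  obtain j1 M1 where 1: "j1 \<le> 11 * j" "run P j1 (pc, M) = (pc + csize c1, M1)" "rep n M1 s'"
    using Seq.IH(1)[of M pc] Seq.prems by auto
  obtain j2 M2 where 2: "j2 \<le> 11 * k"
    "run P j2 (pc + csize c1, M1) = (pc + csize c1 + csize c2, M2)" "rep n M2 s''"
    using Seq.IH(2)[of M1 "pc + csize c1"] Seq.prems 1 by auto
  show ?case using 1 2
    by (intro exI[of _ "j1 + j2"] exI[of _ M2]) (simp add: run_add add.assoc)
next
  case (IfT s r c1 k s' c2)
  have M: "M r > 0" using IfT by (auto simp: rep_def)
  obtain j1 M1 where 1: "j1 \<le> 11 * k"
    "run P j1 (pc + 2 + csize c2, M) = (pc + 2 + csize c2 + csize c1, M1)" "rep n M1 s'"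
    using IfT.IH[of M "pc + 2 + csize c2"] IfT.prems by auto
  show ?case using 1 IfT.prems M
    by (intro exI[of _ "Suc j1"] exI[of _ M1]) (simp add: run_Suc step_exec1)
next
  case (IfF s r c2 k s' c1)
  have M: "\<not> M r > 0" using IfF by (auto simp: rep_def)
  obtain j1 M1 where 1: "j1 \<le> 11 * k"
    "run P j1 (Suc pc, M) = (Suc pc + csize c2, M1)" "rep n M1 s'"
    using IfF.IH[of M "Suc pc"] IfF.prems by auto
  have "run P (Suc (j1 + 1)) (pc, M) = (pc + csize (IfP r c1 c2), M1)"
    unfolding run_Suc run_add using 1 IfF.prems M
    by (simp add: run_add run_Suc run_0 step_exec1)
  then show ?case using 1
    by (intro exI[of _ "Suc (j1 + 1)"] exI[of _ M1]) (simp)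
next
  case (WhileF s r c)
  have M: "\<not> M r > 0" using WhileF by (auto simp: rep_def)
  show ?case using WhileF.prems M
    by (intro exI[of _ "Suc (Suc 0)"] exI[of _ M]) (simp add: run_Suc run_0 step_exec1)
next
  case (WhileT s r c j s' k s'')
  have M: "M r > 0" using WhileT by (auto simp: rep_def)
  obtain j1 M1 where 1: "j1 \<le> 11 * j"
    "run P j1 (pc + 2, M) = (pc + 2 + csize c, M1)" "rep n M1 s'"
    using WhileT.IH(1)[of M "pc + 2"] WhileT.prems by auto
  obtain j2 M2 where 2: "j2 \<le> 11 * k"
    "run P j2 (pc, M1) = (pc + csize (WhileP r c), M2)" "rep n M2 s''"
    using WhileT.IH(2)[of M1 pc] WhileT.prems 1 by auto
  have "run P (Suc (j1 + Suc j2)) (pc, M) = (pc + csize (WhileP r c), M2)"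
    unfolding run_Suc run_add using 1 2 WhileT.prems M
    by (simp add: run_Suc step_exec1 eval_nat_numeral)
  then show ?case using 1 2
    by (intro exI[of _ "Suc (j1 + Suc j2)"] exI[of _ M2]) simp
qed

section \<open>Total correctness with a time bound\<close>

definition wpt :: "com \<Rightarrow> nat \<Rightarrow> (astate \<Rightarrow> bool) \<Rightarrow> astate \<Rightarrow> bool" where
  "wpt c k Q s \<longleftrightarrow> (\<exists>s' j. bs c s j s' \<and> j \<le> k \<and> Q s')"

lemma wpt_mono: "wpt c k Q s \<Longrightarrow> k \<le> k' \<Longrightarrow> (\<And>s'. Q s' \<Longrightarrow> Q' s') \<Longrightarrow> wpt c k' Q' s"
  unfolding wpt_def by (meson le_trans)

lemma wpt_Seq: "wpt c1 j (wpt c2 k Q) s \<Longrightarrow> wpt (c1 ;; c2) (j + k) Q s"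
  unfolding wpt_def by (meson Seq add_mono)

lemma wpt_SeqI:
  "wpt c1 j Q' s \<Longrightarrow> (\<And>R A. Q' (R, A) \<Longrightarrow> wpt c2 k Q (R, A)) \<Longrightarrow> wpt (c1 ;; c2) (j + k) Q s"
  by (rule wpt_Seq, rule wpt_mono[of c1 j Q']) (auto split: prod.splits)

text \<open>The index of \<open>Inv\<close> is the variant: it bounds the remaining rounds, each of
  which pays for one guard and one body. The summand 1 is the final guard.\<close>

lemma wpt_While:
  assumes body: "\<And>i s. Inv i s \<Longrightarrow> fst s r > 0 \<Longrightarrow> wpt c k (\<lambda>s'. \<exists>i' < i. Inv i' s') s"
  shows "Inv i s \<Longrightarrow> wpt (WhileP r c) (i * Suc k + 1) (\<lambda>s'. \<not> fst s' r > 0 \<and> (\<exists>i'. Inv i' s')) s"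
proof (induction i arbitrary: s rule: less_induct)
  case (less i)
  show ?case
  proof (cases "fst s r > 0")
    case False
    then show ?thesis using less.prems unfolding wpt_def
      using WhileF by (intro exI[of _ s] exI[of _ 1]) auto
  next
    case True
    then obtain j s' i' where 1: "bs c s j s'" "j \<le> k" "i' < i" "Inv i' s'"
      using body[OF less.prems] by (auto simp: wpt_def)
    obtain j' s'' where 2: "bs (WhileP r c) s' j' s''" "j' \<le> i' * Suc k + 1"
      "\<not> fst s'' r > 0" "\<exists>i'. Inv i' s''"
      using less.IH[OF 1(3,4)] unfolding wpt_def by blast
    have "Suc i' * Suc k \<le> i * Suc k" using 1(3) by (intro mult_le_mono1) simp
    then have "Suc (j + j') \<le> i * Suc k + 1" using 1 2 by simp
    then show ?thesis unfolding wpt_def using WhileT[OF True 1(1) 2(1)] 2 by blast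
  qed
qed

lemma wpt_countdown:
  assumes body: "\<And>i R A. I (Suc i) R A \<Longrightarrow> R r = int (Suc i) \<Longrightarrow>
    wpt c k (\<lambda>(R', A'). R' r = int i \<and> I i R' A') (R, A)"
  assumes "I i R A" "R r = int i"
  shows "wpt (WhileP r c) (i * Suc k + 1) (\<lambda>(R', A'). I 0 R' A') (R, A)"
proof -
  define Inv where "Inv i s \<longleftrightarrow> fst s r = int i \<and> I i (fst s) (snd s)" for i s
  have "wpt c k (\<lambda>s'. \<exists>i'<i. Inv i' s') s" if "Inv i s" "fst s r > 0" for i s
  proof -
    have "i \<noteq> 0" using that by (auto simp: Inv_def)
    then obtain j where j: "i = Suc j" by (cases i) auto
    show ?thesis
      using body[of j "fst s" "snd s"] that unfolding j Inv_def
      by (auto elim!: wpt_mono)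
  qed
  from wpt_While[of Inv, OF this] assms(2,3)
  have "wpt (WhileP r c) (i * Suc k + 1) (\<lambda>s'. \<not> fst s' r > 0 \<and> (\<exists>i'. Inv i' s')) (R, A)"
    by (simp add: Inv_def)
  then show ?thesis
    by (rule wpt_mono) (auto simp: Inv_def)
qed

fun wp :: "com \<Rightarrow> (astate \<Rightarrow> bool) \<Rightarrow> astate \<Rightarrow> bool" where
  "wp (SetC r c) Q (R, A) = Q (R(r := c), A)"
| "wp (AddR r x y) Q (R, A) = Q (R(r := R x + R y), A)"
| "wp (SubR r x y) Q (R, A) = Q (R(r := R x - R y), A)"
| "wp (HalfR r x) Q (R, A) = Q (R(r := R x div 2), A)"
| "wp (ALd r a x) Q (R, A) = (R x \<ge> 0 \<and> Q (R(r := A a (nat (R x))), A))"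
| "wp (ASt a x r) Q (R, A) = (R x \<ge> 0 \<and> Q (R, put a (nat (R x)) (R r) A))"
| "wp (AInc a x r) Q (R, A) =
     (R x \<ge> 0 \<and> Q (R, incr a (nat (R x)) (R r) A))"
| "wp (c1 ;; c2) Q s = wp c1 (wp c2 Q) s"
| "wp (IfP r c1 c2) Q (R, A) = (if R r > 0 then wp c1 Q (R, A) else wp c2 Q (R, A))"
| "wp (WhileP r c) Q s = False"

text \<open>Without loops every command runs at most once, so the size of the code bounds its cost.
  On loops \<open>wp\<close> is false; they are left to \<open>wpt_While\<close>.\<close>

lemma wp_sound: "wp c Q s \<Longrightarrow> wpt c (csize c) Q s"
proof (induction c arbitrary: Q s)
  case (Seq c1 c2)
  have "wpt c1 (csize c1) (wpt c2 (csize c2) Q) s"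
    using Seq.IH(1)[of "wp c2 Q" s] Seq.IH(2)[of Q] Seq.prems
    by (auto intro: wpt_mono)
  then show ?case by (simp add: wpt_Seq)
next
  case (IfP r c1 c2)
  obtain R A where s: "s = (R, A)" by fastforce
  show ?case
  proof (cases "R r > 0")
    case True
    then obtain s' j where "bs c1 s j s'" "j \<le> csize c1" "Q s'"
      using IfP.IH(1)[of Q s] IfP.prems s unfolding wpt_def by auto
    then show ?thesis using True s IfT[of s r c1 j s' c2] unfolding wpt_def
      by (intro exI[of _ s'] exI[of _ "Suc j"]) auto
  next
    case False
    then obtain s' j where "bs c2 s j s'" "j \<le> csize c2" "Q s'"
      using IfP.IH(2)[of Q s] IfP.prems s unfolding wpt_def by auto
    then show ?thesis using False s IfF[of s r c2 j s' c1] unfolding wpt_def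
      by (intro exI[of _ s'] exI[of _ "Suc j"]) auto
  qed
qed (cases s; fastforce simp: wpt_def intro: bs.intros)+

lemma wpt_wp: "wp c Q s \<Longrightarrow> csize c \<le> k \<Longrightarrow> wpt c k Q s"
  by (rule wpt_mono[OF wp_sound])

section \<open>Trees and partitions\<close>

text \<open>An undirected edge is two darts; \<open>dart f e v\<close> collects the values of \<open>f\<close> on the darts of \<open>e\<close>
  that leave \<open>v\<close>.\<close>

fun dart :: "(nat \<Rightarrow> nat \<Rightarrow> int \<Rightarrow> int \<Rightarrow> int) \<Rightarrow> edge \<Rightarrow> nat \<Rightarrow> int" where
  "dart f (x, y, a, b) v = (if x = v then f x y a b else 0) + (if y = v then f y x b a else 0)"

text \<open>Degrees, neighbour sums, valuation sums and utilities are all instances of this one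
  operator, so a single decomposition at a leaf serves both the stored data and the game.\<close>

definition dsum :: "(nat \<Rightarrow> nat \<Rightarrow> int \<Rightarrow> int \<Rightarrow> int) \<Rightarrow> edge list \<Rightarrow> nat \<Rightarrow> int" where
  "dsum f E v = (\<Sum>e\<leftarrow>E. dart f e v)"

lemma dsum_Nil [simp]: "dsum f [] v = 0"
  and dsum_Cons [simp]: "dsum f (e # E) v = dart f e v + dsum f E v"
  and dsum_append [simp]: "dsum f (E @ F) v = dsum f E v + dsum f F v"
  by (simp_all add: dsum_def)

abbreviation deg :: "edge list \<Rightarrow> nat \<Rightarrow> int" where
  "deg \<equiv> dsum (\<lambda>v y a b. 1)"

definition edges_in :: "nat set \<Rightarrow> edge list \<Rightarrow> bool" where
  "edges_in V E \<longleftrightarrow> (\<forall>(x, y, a, b) \<in> set E. x \<in> V \<and> y \<in> V \<and> x \<noteq> y)"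

lemma edges_in_Cons [simp]:
  "edges_in V ((x, y, a, b) # E) \<longleftrightarrow> x \<in> V \<and> y \<in> V \<and> x \<noteq> y \<and> edges_in V E"
  by (auto simp: edges_in_def)

lemma edges_in_append [simp]: "edges_in V (E @ F) \<longleftrightarrow> edges_in V E \<and> edges_in V F"
  by (simp add: edges_in_def ball_Un)

lemma adj_Cons: "adj ((x, y, a, b) # E) u v \<longleftrightarrow> (u = x \<and> v = y) \<or> (u = y \<and> v = x) \<or> adj E u v"
  by (auto simp: adj_def nbrs_def)

lemma adj_append: "adj (E @ F) u v \<longleftrightarrow> adj E u v \<or> adj F u v"
  by (auto simp: adj_def nbrs_def)

lemma adj_sym: "adj E u v \<Longrightarrow> adj E v u"
  by (auto simp: adj_def nbrs_def)

lemma deg_nonneg: "deg E v \<ge> 0"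
  by (induction E) auto

lemma deg_pos: "adj E v w \<Longrightarrow> deg E v \<ge> 1"
proof (induction E)
  case (Cons e E)
  obtain x y a b where "e = (x, y, a, b)" by (cases e)
  then show ?case using Cons deg_nonneg[of E v] by (auto simp: adj_Cons)
qed (simp add: adj_def nbrs_def)

text \<open>Degree 0 means that no dart leaves \<open>v\<close>. Applied to the tree without its
  leaf, this shows that the sums stored at the leaf are exactly the data of its only edge.\<close>

lemma deg_0_dsum: "deg E v = 0 \<Longrightarrow> dsum f E v = 0"
proof (induction E)
  case (Cons e E)
  obtain x y a b where "e = (x, y, a, b)" by (cases e)
  then show ?case using Cons deg_nonneg[of E v] by (auto split: if_splits)
qed simp

lemma deg_0_edge: "deg E v = 0 \<Longrightarrow> (x, y, a, b) \<in> set E \<Longrightarrow> x \<noteq> v \<and> y \<noteq> v"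
proof (induction E)
  case (Cons e E)
  obtain x' y' a' b' where "e = (x', y', a', b')" by (cases e)
  then show ?case using Cons deg_nonneg[of E v] by (auto split: if_splits)
qed simp

lemma sum_deg:
  assumes "finite V" "edges_in V E"
  shows "(\<Sum>v\<in>V. deg E v) = 2 * int (length E)"
  using assms(2)
proof (induction E)
  case (Cons e E)
  obtain x y a b where "e = (x, y, a, b)" by (cases e)
  then show ?case using Cons assms(1) by (auto simp: sum.distrib)
qed simp

text \<open>The edge may be listed as \<open>(p, v, b, a)\<close>. Swapping its ends together with
  its weights leaves every \<open>dart\<close> value unchanged, so it can be oriented away from the
  leaf.\<close>

lemma leaf_edge:
  assumes "deg E v = 1" "edges_in V E"
  obtains E' p a b where
    "\<And>f u. dsum f E u = dart f (v, p, a, b) u + dsum f E' u"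
    "\<And>u w. adj E u w \<longleftrightarrow> (u = v \<and> w = p) \<or> (u = p \<and> w = v) \<or> adj E' u w"
    "p \<in> V" "p \<noteq> v" "length E = Suc (length E')" "edges_in (V - {v}) E'" "deg E' v = 0"
proof -
  have "\<exists>e \<in> set E. dart (\<lambda>v y a b. 1) e v \<noteq> 0"
  proof (rule ccontr)
    assume "\<not> ?thesis"
    then have "deg E v = 0" by (induction E) auto
    then show False using assms by simp
  qed
  then obtain x y a b where e: "(x, y, a, b) \<in> set E" "x = v \<or> y = v"
    by (auto split: if_splits)
  obtain E1 E2 where E: "E = E1 @ (x, y, a, b) # E2"
    using split_list[OF e(1)] by blast
  have xy: "x \<noteq> y" "x \<in> V" "y \<in> V" using assms E by auto
  have d: "deg (E1 @ E2) v = 0" using assms(1) e(2) xy E by auto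
  have *: "edges_in (V - {v}) (E1 @ E2)"
    unfolding edges_in_def
  proof clarify
    fix x' y' a' b' assume "(x', y', a', b') \<in> set (E1 @ E2)"
    then show "x' \<in> V - {v} \<and> y' \<in> V - {v} \<and> x' \<noteq> y'"
      using deg_0_edge[OF d] assms(2) unfolding E edges_in_def by fastforce
  qed
  show thesis
  proof (cases "x = v")
    case True
    show thesis
      by (rule that[of y a b "E1 @ E2"])
         (use True xy d * in \<open>auto simp: E adj_append adj_Cons\<close>)
  next
    case False
    then have "y = v" using e by simp
    then show thesis
      by (intro that[of x b a "E1 @ E2"])
         (use xy d * in \<open>auto simp: E adj_append adj_Cons\<close>)
  qed
qed

section \<open>Trees and the removal of leaves\<close>

definition tree_on :: "nat set \<Rightarrow> edge list \<Rightarrow> bool" where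
  "tree_on V E \<longleftrightarrow> finite V \<and> card V = Suc (length E) \<and> edges_in V E \<and>
     (\<forall>u\<in>V. \<forall>w\<in>V. (adj E)\<^sup>*\<^sup>* u w)"

lemma tree_game_tree_on:
  assumes "is_tree_game n es"
  shows "tree_on {..<n} es"
proof -
  have sym: "(adj es)\<^sup>*\<^sup>* v u" if "(adj es)\<^sup>*\<^sup>* u v" for u v
    using that by induction (auto intro: adj_sym converse_rtranclp_into_rtranclp)
  have "(adj es)\<^sup>*\<^sup>* 0 v" if "v < n" for v using assms that by (auto simp: is_tree_game_def)
  then have "(adj es)\<^sup>*\<^sup>* u w" if "u < n" "w < n" for u w
    using sym that by (meson rtranclp_trans)
  then show ?thesis using assms
    by (auto simp: tree_on_def is_tree_game_def edges_in_def)
qed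

lemma tree_deg_pos:
  assumes "tree_on V E" "E \<noteq> []" "v \<in> V"
  shows "deg E v \<ge> 1"
proof -
  have "card V \<ge> 2" using assms by (cases E) (auto simp: tree_on_def)
  then obtain w where "w \<in> V" "w \<noteq> v"
    by (metis One_nat_def card_le_Suc0_iff_eq assms(1) assms(3) not_less_eq_eq numeral_2_eq_2 tree_on_def)
  then have "(adj E)\<^sup>*\<^sup>* v w" using assms by (auto simp: tree_on_def)
  then obtain z where "adj E v z" using \<open>w \<noteq> v\<close> by (metis converse_rtranclpE)
  then show ?thesis by (rule deg_pos)
qed

text \<open>Handshake count: if all degrees were at least 2, their sum, twice the number of edges,
  would reach twice the number of vertices, which exceeds it by 2.\<close>

lemma tree_leaf:
  assumes "tree_on V E" "E \<noteq> []"
  shows "\<exists>v\<in>V. deg E v = 1"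
proof (rule ccontr)
  assume "\<not> ?thesis"
  then have "deg E v \<ge> 2" if "v \<in> V" for v
    using tree_deg_pos[OF assms that] that by force
  then have "(\<Sum>v\<in>V. 2) \<le> (\<Sum>v\<in>V. deg E v)" by (intro sum_mono) auto
  also have "\<dots> = 2 * int (length E)"
    using assms by (intro sum_deg) (auto simp: tree_on_def)
  finally show False using assms by (auto simp: tree_on_def)
qed

text \<open>Connectivity survives because contracting the leaf onto its neighbour maps walks to walks.\<close>

lemma tree_remove_leaf:
  assumes "tree_on V E" "v \<in> V" "p \<in> V" "p \<noteq> v" "length E = Suc (length E')"
    "edges_in (V - {v}) E'"
    and adj: "\<And>u w. adj E u w \<longleftrightarrow> (u = v \<and> w = p) \<or> (u = p \<and> w = v) \<or> adj E' u w"
  shows "tree_on (V - {v}) E'"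
proof -
  define f where "f z = (if z = v then p else z)" for z
  have "(adj E')\<^sup>*\<^sup>* (f u) (f w)" if "(adj E)\<^sup>*\<^sup>* u w" for u w
    using that
  proof induction
    case (step y z)
    have "f y = f z \<or> adj E' (f y) (f z)"
    proof (cases "adj E' y z")
      case True
      then have "y \<noteq> v" "z \<noteq> v"
        using assms(6) by (auto simp: adj_def nbrs_def edges_in_def)
      then show ?thesis using True by (simp add: f_def)
    qed (use step(2) adj in \<open>auto simp: f_def\<close>)
    then show ?case using step.IH by (metis rtranclp.rtrancl_into_rtrancl)
  qed simp
  moreover have "(adj E)\<^sup>*\<^sup>* u w" if "u \<in> V" "w \<in> V" for u w
    using assms(1) that by (auto simp: tree_on_def)
  ultimately have "(adj E')\<^sup>*\<^sup>* u w" if "u \<in> V - {v}" "w \<in> V - {v}" for u w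
    using that unfolding f_def by (metis DiffE insertI1)
  then show ?thesis using assms by (auto simp: tree_on_def)
qed

text \<open>The sums over neighbours and over list entries are exchanged: an entry incident to
  \<open>u\<close> can contribute only through its other end.\<close>

lemma utility_dsum:
  assumes "edges_in {..<n} es" "u < n"
  shows "utility n es q u = dsum (\<lambda>v y a b. if q v = q y then a else 0) es u"
proof -
  define S where "S = nbrs es u \<inter> coalition n q u"
  have fin: "finite S" by (simp add: S_def coalition_def)
  have sum_swap: "(\<Sum>v\<in>S. sum_list (map (g v) E)) = (\<Sum>e\<leftarrow>E. \<Sum>v\<in>S. g v e)"
    for g :: "nat \<Rightarrow> edge \<Rightarrow> int" and E
    by (induction E) (auto simp: sum.distrib)
  have "(\<Sum>v\<in>S. (if x = u \<and> y = v then a else 0) + (if x = v \<and> y = u then b else 0)) =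
      dart (\<lambda>v y a b. if q v = q y then a else 0) (x, y, a, b) u"
    if "(x, y, a, b) \<in> set es" for x y a b
  proof -
    have xy: "x \<noteq> y" "x < n" "y < n" using assms(1) that by (auto simp: edges_in_def)
    have 1: "y \<in> S \<longleftrightarrow> q y = q u" if "x = u"
      using xy \<open>(x, y, a, b) \<in> set es\<close> that by (auto simp: S_def nbrs_def coalition_def)
    have 2: "x \<in> S \<longleftrightarrow> q x = q u" if "y = u"
      using xy \<open>(x, y, a, b) \<in> set es\<close> that by (auto simp: S_def nbrs_def coalition_def)
    show ?thesis using 1 2 xy fin by (cases "x = u"; cases "y = u") auto
  qed
  then have "(\<Sum>e\<leftarrow>es. \<Sum>v\<in>S. (case e of (x, y, a, b) \<Rightarrow>
      (if x = u \<and> y = v then a else 0) + (if x = v \<and> y = u then b else 0))) =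
      dsum (\<lambda>v y a b. if q v = q y then a else 0) es u"
    unfolding dsum_def by (intro arg_cong[of _ _ sum_list] map_cong refl) auto
  then show ?thesis
    unfolding utility_def wt_def S_def[symmetric] sum_swap .
qed

text \<open>Edge \<open>k\<close> joins \<open>v k\<close> to \<open>p k\<close>, and \<open>v k\<close> is a leaf of the tree formed by the edges
  \<open>0, ..., k\<close>: leaves are stripped in decreasing order of \<open>k\<close>.\<close>

locale elimination =
  fixes n m :: nat and es :: "edge list" and v p :: "nat \<Rightarrow> nat" and a b :: "nat \<Rightarrow> int"
  assumes n_pos: "n \<ge> 1"
    and m_eq: "m = n - 1"
    and edges_in_range: "edges_in {..<n} es"
    and v_less: "k < m \<Longrightarrow> v k < n"
    and p_less: "k < m \<Longrightarrow> p k < n"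
    and v_neq_p: "k < m \<Longrightarrow> v k \<noteq> p k"
    and fresh: "k < m \<Longrightarrow> j < k \<Longrightarrow> v k \<noteq> v j \<and> v k \<noteq> p j"
    and dsum_es: "dsum f es u = (\<Sum>k<m. dart f (v k, p k, a k, b k) u)"
begin

section \<open>Kept edges, feasible thresholds and the greedy choice\<close>

definition gain :: "nat \<Rightarrow> nat \<Rightarrow> int" where
  "gain k u = (if v k = u then a k else 0) + (if p k = u then b k else 0)"

definition feasible :: "int \<Rightarrow> bool" where
  "feasible t \<longleftrightarrow> (\<exists>q. \<forall>u<n. t \<le> utility n es q u)"

lemma utility_gain:
  assumes "u < n"
  shows "utility n es q u = (\<Sum>k<m. if q (v k) = q (p k) then gain k u else 0)"
  unfolding utility_dsum[OF edges_in_range assms] dsum_es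
  by (intro sum.cong) (auto simp: gain_def)

text \<open>Besides the choices made so far it records that a vertex not yet touched is alone under
  its own number. This keeps the two ends apart when the edge that introduces the vertex is
  cut.\<close>

definition lab_inv :: "nat \<Rightarrow> (nat \<Rightarrow> bool) \<Rightarrow> (nat \<Rightarrow> int) \<Rightarrow> bool" where
  "lab_inv k x l \<longleftrightarrow> (\<forall>j<k. l (v j) = l (p j) \<longleftrightarrow> x j) \<and>
     (\<forall>w<n. (\<forall>j<k. w \<noteq> v j \<and> w \<noteq> p j) \<longrightarrow> (\<forall>u<n. l u = int w \<longleftrightarrow> u = w))"

lemma lab_inv_0: "\<forall>u<n. l u = int u \<Longrightarrow> lab_inv 0 x l"
  by (simp add: lab_inv_def)

lemma lab_inv_Suc:
  assumes "lab_inv k x l" "k < m"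
  shows "lab_inv (Suc k) x (if x k then l(v k := l (p k)) else l)"
proof -
  have vk: "\<forall>j<k. v k \<noteq> v j \<and> v k \<noteq> p j" "v k < n" "p k < n" "v k \<noteq> p k"
    using assms(2) fresh v_less p_less v_neq_p by auto
  then have l: "l u = int (v k) \<longleftrightarrow> u = v k" if "u < n" for u
    using assms(1) that by (auto simp: lab_inv_def)
  then have l2: "l (v k) \<noteq> l (p k)" using vk by metis
  show ?thesis
    using assms(1) vk l2 unfolding lab_inv_def by (auto simp: less_Suc_eq)
qed

lemma lab_inv_exists: "k \<le> m \<Longrightarrow> \<exists>l. lab_inv k x l"
proof (induction k)
  case 0
  then show ?case using lab_inv_0[of int] by auto
next
  case (Suc k)
  then show ?case using lab_inv_Suc by (meson Suc_leD Suc_le_lessD)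
qed

lemma lab_inv_utility:
  assumes "lab_inv m x l" "u < n"
  shows "utility n es l u = (\<Sum>k<m. if x k then gain k u else 0)"
  unfolding utility_gain[OF assms(2)] using assms(1)
  by (intro sum.cong) (auto simp: lab_inv_def)

text \<open>Every choice of kept edges comes from a labelling: inserted in increasing order, each
  edge brings a new vertex \<open>v k\<close>, which either takes the label of \<open>p k\<close> or
  keeps its own.\<close>

lemma feasible_iff: "feasible t \<longleftrightarrow> (\<exists>x. \<forall>u<n. t \<le> (\<Sum>k<m. if x k then gain k u else 0))"
proof
  assume "feasible t"
  then obtain q where "\<forall>u<n. t \<le> utility n es q u" by (auto simp: feasible_def)
  then show "\<exists>x. \<forall>u<n. t \<le> (\<Sum>k<m. if x k then gain k u else 0)"
    by (intro exI[of _ "\<lambda>k. q (v k) = q (p k)"]) (auto simp: utility_gain)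
next
  assume "\<exists>x. \<forall>u<n. t \<le> (\<Sum>k<m. if x k then gain k u else 0)"
  then show "feasible t"
    using lab_inv_exists[of m] lab_inv_utility unfolding feasible_def by (metis le_refl)
qed

text \<open>A promise rather than a comparison: if there is a solution at all, some completion of
  the choices made so far is one. At \<open>k = 0\<close> nothing is left to complete, so
  \<open>acc\<close> decides feasibility.\<close>

definition greedy_inv :: "int \<Rightarrow> nat \<Rightarrow> (nat \<Rightarrow> bool) \<Rightarrow> (nat \<Rightarrow> int) \<Rightarrow> bool" where
  "greedy_inv t k x acc \<longleftrightarrow>
     (\<forall>u<n. acc u = (\<Sum>j\<in>{k..<m}. if x j then gain j u else 0)) \<and>
     (feasible t \<longrightarrow> (\<exists>y. \<forall>u<n. t \<le> acc u + (\<Sum>j<k. if y j then gain j u else 0)))"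

lemma greedy_inv_start: "\<forall>u<n. acc u = 0 \<Longrightarrow> greedy_inv t m x acc"
  by (simp add: greedy_inv_def feasible_iff)

definition pick :: "int \<Rightarrow> nat \<Rightarrow> (nat \<Rightarrow> int) \<Rightarrow> bool" where
  "pick t k acc \<longleftrightarrow> t \<le> acc (v k) + a k \<and> (acc (v k) < t \<or> b k > 0)"

text \<open>Only edge \<open>k\<close> can still help \<open>v k\<close>, so an admissible choice stays admissible when it is
  replaced by the one that satisfies \<open>v k\<close> and serves \<open>p k\<close> best.\<close>

lemma greedy_inv_step:
  assumes inv: "greedy_inv t (Suc k) x acc" and k: "k < m"
  shows "greedy_inv t k (x(k := pick t k acc))
    (if pick t k acc then (\<lambda>u. acc u + gain k u) else acc)"
proof -
  let ?x = "x(k := pick t k acc)"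
  let ?acc = "if pick t k acc then (\<lambda>u. acc u + gain k u) else acc"
  have "{k..<m} = insert k {Suc k..<m}" using k by auto
  then have "(\<Sum>j\<in>{k..<m}. if ?x j then gain j u else 0) =
      (if pick t k acc then gain k u else 0) + (\<Sum>j\<in>{Suc k..<m}. if x j then gain j u else 0)" for u
    by (simp cong: sum.cong_simp)
  then have 1: "\<forall>u<n. ?acc u = (\<Sum>j\<in>{k..<m}. if ?x j then gain j u else 0)"
    using inv by (auto simp: greedy_inv_def)
  have "\<exists>y. \<forall>u<n. t \<le> ?acc u + (\<Sum>j<k. if y j then gain j u else 0)" if f: "feasible t"
  proof -
    obtain y where y: "\<forall>u<n. t \<le> acc u + (\<Sum>j<Suc k. if y j then gain j u else 0)"
      using inv f by (auto simp: greedy_inv_def)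
    \<comment> \<open>The undecided edges below \<open>k\<close> do not meet the leaf
      \<open>v k\<close>, so \<open>y k\<close> alone settles whether it is satisfied.\<close>
    have "gain j (v k) = 0" if "j < k" for j
      using fresh[OF k that] by (auto simp: gain_def)
    then have z: "(\<Sum>j<k. if y j then gain j (v k) else 0) = 0" by (intro sum.neutral) auto
    have "t \<le> acc (v k) + (if y k then gain k (v k) else 0)"
      using y[rule_format, OF v_less[OF k]] z by simp
    then have vk: "t \<le> acc (v k) + (if y k then a k else 0)"
      using v_neq_p[OF k] by (simp add: gain_def split: if_splits)
    have "t \<le> ?acc u + (\<Sum>j<k. if y j then gain j u else 0)" if u: "u < n" for u
    proof (cases "u = v k")
      case True
      then show ?thesis using vk z v_neq_p[OF k]
        by (auto simp: pick_def gain_def split: if_splits)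
    next
      case False
      have "t \<le> acc u + (if y k then gain k u else 0) + (\<Sum>j<k. if y j then gain j u else 0)"
        using y u by (simp add: algebra_simps)
      \<comment> \<open>Where the two choices differ, \<open>vk\<close> fixes a sign: an edge kept
        by \<open>y\<close> is rejected only if \<open>b k \<le> 0\<close>, and an edge cut by
        \<open>y\<close> is taken only if \<open>b k > 0\<close>.\<close>
      moreover have "(if y k then gain k u else 0) \<le> (if pick t k acc then gain k u else 0)"
        using False vk by (auto simp: pick_def gain_def split: if_splits)
      ultimately show ?thesis by (auto split: if_splits)
    qed
    then show ?thesis by blast
  qed
  then show ?thesis using 1 by (auto simp: greedy_inv_def)
qed

lemma greedy_inv_feasible:
  assumes "greedy_inv t 0 x acc"
  shows "feasible t \<longleftrightarrow> (\<forall>u<n. t \<le> acc u)"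
  using assms by (auto simp: greedy_inv_def feasible_iff atLeast0LessThan)

lemma feasible_0: "feasible 0"
  unfolding feasible_iff by (rule exI[of _ "\<lambda>_. False"]) simp

text \<open>One agent is enough: the absolute valuations of agent 0 bound whatever it can
  obtain.\<close>

lemma feasible_Wmax:
  assumes "feasible t"
  shows "t \<le> Wmax n es"
proof -
  obtain q where "t \<le> utility n es q 0" using assms n_pos by (auto simp: feasible_def)
  also have "\<dots> \<le> (\<Sum>w \<in> nbrs es 0 \<inter> coalition n q 0. \<bar>wt es 0 w\<bar>)"
    unfolding utility_def by (intro sum_mono) auto
  also have "\<dots> \<le> (\<Sum>w \<in> nbrs es 0. \<bar>wt es 0 w\<bar>)"
  proof (intro sum_mono2)
    have "nbrs es 0 \<subseteq> {..<n}" using edges_in_range by (auto simp: nbrs_def edges_in_def)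
    then show "finite (nbrs es 0)" by (rule finite_subset) simp
  qed auto
  also have "\<dots> \<le> Wmax n es"
    unfolding Wmax_def using n_pos by (intro Max_ge) auto
  finally show ?thesis .
qed

lemma max_egalitarianI:
  assumes "\<forall>u<n. t \<le> utility n es l u" "\<not> feasible (t + 1)"
  shows "max_egalitarian n es l"
proof -
  have "egal_welfare n es q \<le> t" for q
  proof (rule ccontr)
    assume "\<not> egal_welfare n es q \<le> t"
    then have "t + 1 \<le> utility n es q u" if "u < n" for u
    proof -
      have "egal_welfare n es q \<le> utility n es q u"
        unfolding egal_welfare_def using that by (intro Min_le) auto
      then show ?thesis using \<open>\<not> egal_welfare n es q \<le> t\<close> by simp
    qed
    then show False using assms(2) by (auto simp: feasible_def)
  qed
  moreover have "t \<le> egal_welfare n es l"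
    using assms(1) n_pos by (auto simp: egal_welfare_def)
  ultimately show ?thesis unfolding max_egalitarian_def by (meson order_trans)
qed

end

section \<open>The program\<close>

text \<open>Registers: 8 and 9 hold the constants 1 and 0, 10 holds \<open>n\<close>, 15 holds \<open>n - 1\<close>, 12 the threshold
  under test, 13 and 14 the bounds of the bisection, 29 the answer of a test; the others from 20 on
  are temporary. Arrays: 0 is the input; 1, 2, 3, 4 hold for every vertex the degree, the sum of the
  neighbours and the sums of outgoing and incoming valuations; 5, 6, 7, 8 hold for every stripped
  edge the leaf \<open>v\<close>, its neighbour \<open>p\<close> and the valuations of \<open>v\<close> for \<open>p\<close> and of \<open>p\<close> for \<open>v\<close>; 9 tells which
  of these edges are kept; 10 accumulates utilities; 11 holds the labels.\<close>

definition base_regs :: "nat \<Rightarrow> (nat \<Rightarrow> int) \<Rightarrow> bool" where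
  "base_regs n R \<longleftrightarrow> R 8 = 1 \<and> R 9 = 0 \<and> R 10 = int n \<and> R 15 = int n - 1"

definition input_array :: "edge list \<Rightarrow> (nat \<Rightarrow> nat \<Rightarrow> int) \<Rightarrow> bool" where
  "input_array es A \<longleftrightarrow> (\<forall>i<length es. \<forall>u w a b. es ! i = (u, w, a, b) \<longrightarrow>
     A 0 (4 * i) = int u \<and> A 0 (4 * i + 1) = int w \<and> A 0 (4 * i + 2) = a \<and> A 0 (4 * i + 3) = b)"

definition stats :: "nat set \<Rightarrow> edge list \<Rightarrow> (nat \<Rightarrow> nat \<Rightarrow> int) \<Rightarrow> bool" where
  "stats V E A \<longleftrightarrow> (\<forall>u\<in>V. A 1 u = deg E u \<and> A 2 u = dsum (\<lambda>v y a b. int y) E u \<and>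
     A 3 u = dsum (\<lambda>v y a b. a) E u \<and> A 4 u = dsum (\<lambda>v y a b. b) E u)"

section \<open>Computing the vertex sums of the input tree\<close>

definition clear_body :: com where
  "clear_body = SubR 20 20 8 ;; ASt 1 20 9 ;; ASt 2 20 9 ;; ASt 3 20 9 ;; ASt 4 20 9"

definition edge_body :: com where
  "edge_body = SubR 20 20 8 ;; AddR 21 20 20 ;; AddR 21 21 21 ;; ALd 22 0 21 ;; AddR 21 21 8 ;;
     ALd 23 0 21 ;; AddR 21 21 8 ;; ALd 24 0 21 ;; AddR 21 21 8 ;; ALd 25 0 21 ;;
     AInc 1 22 8 ;; AInc 2 22 23 ;; AInc 3 22 24 ;; AInc 4 22 25 ;;
     AInc 1 23 8 ;; AInc 2 23 22 ;; AInc 3 23 25 ;; AInc 4 23 24"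

definition build :: com where
  "build = AddR 20 10 9 ;; WhileP 20 clear_body ;; AddR 20 15 9 ;; WhileP 20 edge_body"

lemma clear_body_spec:
  assumes "R 20 = int (Suc i)" "R 8 = 1" "R 9 = 0"
  shows "wpt clear_body 40 (\<lambda>(R', A'). R' 20 = int i \<and> (\<forall>r<20. R' r = R r) \<and>
    A' = put 4 i 0 (put 3 i 0 (put 2 i 0 (put 1 i 0 A)))) (R, A)"
  by (rule wpt_wp) (use assms in \<open>auto simp: clear_body_def\<close>)

lemma edge_body_spec:
  assumes "R 20 = int (Suc i)" "R 8 = 1"
    and "A 0 (4 * i) = int u" "A 0 (4 * i + 1) = int w" "A 0 (4 * i + 2) = a" "A 0 (4 * i + 3) = b"
    and "u \<noteq> w"
  shows "wpt edge_body 200 (\<lambda>(R', A'). R' 20 = int i \<and> (\<forall>r<20. R' r = R r) \<and>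
    A' = incr 4 w a (incr 3 w b (incr 2 w (int u) (incr 1 w 1
      (incr 4 u b (incr 3 u a (incr 2 u (int w) (incr 1 u 1 A)))))))) (R, A)"
proof (rule wpt_wp)
  have "nat (4 * int i) = 4 * i" "nat (4 * int i + 1) = 4 * i + 1"
    "nat (2 + 4 * int i) = 4 * i + 2" "nat (3 + 4 * int i) = 4 * i + 3"
    by simp_all
  then show "wp edge_body (\<lambda>(R', A'). R' 20 = int i \<and> (\<forall>r<20. R' r = R r) \<and>
    A' = incr 4 w a (incr 3 w b (incr 2 w (int u) (incr 1 w 1
      (incr 4 u b (incr 3 u a (incr 2 u (int w) (incr 1 u 1 A)))))))) (R, A)"
    using assms by (simp add: edge_body_def)
qed (simp add: edge_body_def)

lemma build_spec:
  assumes "base_regs n R" "input_array es A" "edges_in {..<n} es" "length es = n - 1" "n \<ge> 1"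
  shows "wpt build (300 * n) (\<lambda>(R', A'). base_regs n R' \<and> stats {..<n} es A') (R, A)"
proof -
  define I1 where "I1 i R' A' \<longleftrightarrow> base_regs n R' \<and> input_array es A' \<and>
      (\<forall>u<n. i \<le> u \<longrightarrow> A' 1 u = 0 \<and> A' 2 u = 0 \<and> A' 3 u = 0 \<and> A' 4 u = 0)"
    for i R' and A' :: "nat \<Rightarrow> nat \<Rightarrow> int"
  \<comment> \<open>Edges are read from the last to the first, so those already entered form a
    suffix of the list.\<close>
  define I2 where "I2 i R' A' \<longleftrightarrow> base_regs n R' \<and> input_array es A' \<and>
      stats {..<n} (drop i es) A' \<and> i \<le> length es"
    for i R' and A' :: "nat \<Rightarrow> nat \<Rightarrow> int"
  have l1: "wpt (WhileP 20 clear_body) (n * Suc 40 + 1) (\<lambda>(R', A'). I1 0 R' A') (R', A')"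
    if "I1 n R' A'" "R' 20 = int n" for R' A'
  proof (rule wpt_countdown[of I1])
    fix i R1 A1 assume 1: "I1 (Suc i) R1 A1" "R1 20 = int (Suc i)"
    then show "wpt clear_body 40 (\<lambda>(R2, A2). R2 20 = int i \<and> I1 i R2 A2) (R1, A1)"
      by (intro wpt_mono[OF clear_body_spec])
         (auto simp: I1_def base_regs_def input_array_def le_less_Suc_eq Suc_le_eq le_less)
  qed (use that in auto)
  have l2: "wpt (WhileP 20 edge_body) ((n - 1) * Suc 200 + 1) (\<lambda>(R', A'). I2 0 R' A') (R', A')"
    if "I2 (n - 1) R' A'" "R' 20 = int (n - 1)" for R' A'
  proof (rule wpt_countdown[of I2])
    fix i R1 A1 assume 1: "I2 (Suc i) R1 A1" "R1 20 = int (Suc i)"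
    obtain u w a b where e: "es ! i = (u, w, a, b)" by (metis prod.exhaust)
    have i: "i < length es" using 1 by (simp add: I2_def)
    then have "(u, w, a, b) \<in> set es" using e by (metis nth_mem)
    then have uw: "u \<noteq> w" "u < n" "w < n" using assms(3) by (auto simp: edges_in_def)
    have d: "drop i es = (u, w, a, b) # drop (Suc i) es"
      using i e by (metis Cons_nth_drop_Suc)
    show "wpt edge_body 200 (\<lambda>(R2, A2). R2 20 = int i \<and> I2 i R2 A2) (R1, A1)"
    proof (rule wpt_mono[OF edge_body_spec])
      show "A1 0 (4 * i) = int u" "A1 0 (4 * i + 1) = int w" "A1 0 (4 * i + 2) = a" "A1 0 (4 * i + 3) = b"
        using 1 i e by (auto simp: I2_def input_array_def)
    qed (use 1 uw i in \<open>auto simp: I2_def base_regs_def input_array_def stats_def d\<close>)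
  qed (use that in auto)
  have "wpt build (1 + ((n * Suc 40 + 1) + (1 + ((n - 1) * Suc 200 + 1))))
     (\<lambda>(R', A'). I2 0 R' A') (R, A)"
    unfolding build_def
  proof (intro wpt_SeqI)
    show "wpt (AddR 20 10 9) 1 (\<lambda>(R', A'). I1 n R' A' \<and> R' 20 = int n) (R, A)"
      by (rule wpt_wp) (use assms in \<open>auto simp: I1_def base_regs_def\<close>)
    show "wpt (WhileP 20 clear_body) (n * Suc 40 + 1) (\<lambda>(R', A'). I1 0 R' A') (R', A')"
      if "case (R', A') of (R', A') \<Rightarrow> I1 n R' A' \<and> R' 20 = int n" for R' A'
      using that l1 by simp
    show "wpt (AddR 20 15 9) 1 (\<lambda>(R', A'). I2 (n - 1) R' A' \<and> R' 20 = int (n - 1)) (R', A')"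
      if "case (R', A') of (R', A') \<Rightarrow> I1 0 R' A'" for R' A'
      by (rule wpt_wp) (use assms that in \<open>auto simp: I1_def I2_def base_regs_def stats_def\<close>)
    show "wpt (WhileP 20 edge_body) ((n - 1) * Suc 200 + 1) (\<lambda>(R', A'). I2 0 R' A') (R', A')"
      if "case (R', A') of (R', A') \<Rightarrow> I2 (n - 1) R' A' \<and> R' 20 = int (n - 1)" for R' A'
      using that l2 by simp
  qed
  then show ?thesis by (rule wpt_mono) (use assms(5) in \<open>auto simp: I2_def\<close>)
qed

section \<open>Stripping leaves in linear time\<close>

definition strip_body :: com where
  "strip_body = ALd 23 1 22 ;; SubR 24 23 8 ;;
     IfP 24 (SubR 21 21 8 ;; AddR 22 21 9)
       (SubR 20 20 8 ;; ALd 25 2 22 ;; ALd 26 3 22 ;; ALd 27 4 22 ;;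
        ASt 5 20 22 ;; ASt 6 20 25 ;; ASt 7 20 26 ;; ASt 8 20 27 ;;
        SetC 28 2 ;; ASt 1 22 28 ;;
        SubR 28 9 8 ;; AInc 1 25 28 ;; SubR 28 9 22 ;; AInc 2 25 28 ;;
        SubR 28 9 27 ;; AInc 3 25 28 ;; SubR 28 9 26 ;; AInc 4 25 28 ;; AddR 22 25 9)"

definition strip :: com where
  "strip = (AddR 20 15 9 ;; AddR 21 10 9 ;; AddR 22 9 9) ;; WhileP 20 strip_body"

lemma strip_body_scan:
  assumes "R 8 = 1" "R 9 = 0" "R 22 = int v" "A 1 v > 1"
  shows "wpt strip_body 400 (\<lambda>(R', A'). R' 20 = R 20 \<and> R' 21 = R 21 - 1 \<and> R' 22 = R 21 - 1 \<and>
    (\<forall>r<20. R' r = R r) \<and> A' = A) (R, A)"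
  by (rule wpt_wp) (use assms in \<open>simp_all add: strip_body_def\<close>)

text \<open>The stored degree 2 makes a removed vertex look like a non-leaf, so the scan skips it.
  Arrays 3 and 4 change roles at \<open>p\<close>: what is incoming at \<open>v\<close> is outgoing
  at \<open>p\<close>.\<close>

lemma strip_body_leaf:
  assumes "R 8 = 1" "R 9 = 0" "R 22 = int v" "\<not> A 1 v > 1" "R 20 = int (Suc k)"
    and "A 2 v = int p" "A 3 v = a" "A 4 v = b"
  shows "wpt strip_body 400 (\<lambda>(R', A'). R' 20 = int k \<and> R' 21 = R 21 \<and> R' 22 = int p \<and>
    (\<forall>r<20. R' r = R r) \<and> A' = incr 4 p (- a) (incr 3 p (- b) (incr 2 p (- int v) (incr 1 p (- 1)
      (put 1 v 2 (put 8 k b (put 7 k a (put 6 k (int p) (put 5 k (int v) A))))))))) (R, A)"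
  by (rule wpt_wp) (use assms in \<open>simp_all add: strip_body_def\<close>)

text \<open>The edges \<open>E\<close> are still to be stripped and the entries \<open>length E, ..., m - 1\<close> of the order
  arrays are filled.\<close>

definition strip_inv :: "nat \<Rightarrow> nat \<Rightarrow> edge list \<Rightarrow> edge list \<Rightarrow> nat set \<Rightarrow>
    (nat \<Rightarrow> nat \<Rightarrow> int) \<Rightarrow> bool" where
  "strip_inv n m es E V A \<longleftrightarrow> tree_on V E \<and> V \<subseteq> {..<n} \<and> stats V E A \<and>
     (\<forall>j<n. j \<notin> V \<longrightarrow> A 1 j \<ge> 2) \<and> length E \<le> m \<and>
     (\<forall>k<m. length E \<le> k \<longrightarrow> (\<exists>v p. A 5 k = int v \<and> A 6 k = int p \<and> v < n \<and> p < n \<and> v \<noteq> p \<and>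
        v \<notin> V \<and> (\<forall>j<k. length E \<le> j \<longrightarrow> A 5 j \<noteq> int v \<and> A 6 j \<noteq> int v))) \<and>
     (\<forall>f u. dsum f es u = dsum f E u +
        (\<Sum>k\<in>{length E..<m}. dart f (nat (A 5 k), nat (A 6 k), A 7 k, A 8 k) u))"

text \<open>Vertices outside \<open>V\<close> carry marks of at least 2, and a tree with an edge has
  no isolated vertex, so a stored degree of at most 1 certifies a leaf of the current tree. Only the
  entry of \<open>p\<close> is decremented, hence only \<open>p\<close> can turn into a leaf; the
  last conclusion records this for the scan.\<close>

lemma strip_inv_leaf:
  assumes inv: "strip_inv n m es E V A" and E: "length E = Suc k" and v: "v < n" "\<not> A 1 v > 1"
  obtains E' V' p a b where "length E' = k" "A 2 v = int p" "A 3 v = a" "A 4 v = b" "p < n" "p \<noteq> v"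
    "\<And>A'. A' = incr 4 p (- a) (incr 3 p (- b) (incr 2 p (- int v) (incr 1 p (- 1)
       (put 1 v 2 (put 8 k b (put 7 k a (put 6 k (int p) (put 5 k (int v) A)))))))) \<Longrightarrow>
     strip_inv n m es E' V' A' \<and> (\<forall>j<n. A 1 j \<noteq> 1 \<longrightarrow> j \<noteq> p \<longrightarrow> A' 1 j \<noteq> 1) \<and> A' 1 v \<noteq> 1"
proof -
  have tree: "tree_on V E" and V: "V \<subseteq> {..<n}" and st: "stats V E A"
    and out: "\<And>j. j < n \<Longrightarrow> j \<notin> V \<Longrightarrow> A 1 j \<ge> 2" and m: "Suc k \<le> m"
    and ord: "\<And>i. i < m \<Longrightarrow> Suc k \<le> i \<Longrightarrow> \<exists>v p. A 5 i = int v \<and> A 6 i = int p \<and> v < n \<and> p < n \<and>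
        v \<noteq> p \<and> v \<notin> V \<and> (\<forall>j<i. Suc k \<le> j \<longrightarrow> A 5 j \<noteq> int v \<and> A 6 j \<noteq> int v)"
    and ds: "\<And>f u. dsum f es u = dsum f E u +
        (\<Sum>i\<in>{Suc k..<m}. dart f (nat (A 5 i), nat (A 6 i), A 7 i, A 8 i) u)"
    using inv unfolding strip_inv_def E by auto
  have vV: "v \<in> V" using out v by force
  have "E \<noteq> []" using E by auto
  then have "deg E v \<ge> 1" using tree_deg_pos[OF tree _ vV] by simp
  then have "deg E v = 1" using st vV v(2) by (auto simp: stats_def)
  moreover have "edges_in V E" using tree by (simp add: tree_on_def)
  ultimately obtain E' p a b where
    E': "\<And>f u. dsum f E u = dart f (v, p, a, b) u + dsum f E' u"
      "\<And>u w. adj E u w \<longleftrightarrow> (u = v \<and> w = p) \<or> (u = p \<and> w = v) \<or> adj E' u w"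
      "p \<in> V" "p \<noteq> v" "length E = Suc (length E')" "edges_in (V - {v}) E'" "deg E' v = 0"
    by (rule leaf_edge) blast
  have "dsum f E' v = 0" for f using deg_0_dsum[OF E'(7)] .
  then have A: "A 2 v = int p" "A 3 v = a" "A 4 v = b"
    using st vV E'(1,4) by (auto simp: stats_def)
  have k: "length E' = k" using E'(5) E by simp
  have tree': "tree_on (V - {v}) E'"
    by (rule tree_remove_leaf[OF tree vV E'(3-6) E'(2)])
  have split: "{k..<m} = insert k {Suc k..<m}" using m by auto
  have "strip_inv n m es E' (V - {v}) A' \<and> (\<forall>j<n. A 1 j \<noteq> 1 \<longrightarrow> j \<noteq> p \<longrightarrow> A' 1 j \<noteq> 1) \<and> A' 1 v \<noteq> 1"
    if A': "A' = incr 4 p (- a) (incr 3 p (- b) (incr 2 p (- int v) (incr 1 p (- 1)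
       (put 1 v 2 (put 8 k b (put 7 k a (put 6 k (int p) (put 5 k (int v) A))))))))" for A'
  proof -
    have "stats (V - {v}) E' A'"
      using st E'(1,3,4) unfolding stats_def A' by auto
    moreover have "\<forall>j<n. j \<notin> V - {v} \<longrightarrow> A' 1 j \<ge> 2"
      using out E'(3,4) unfolding A' by auto
    moreover have "\<forall>i<m. k \<le> i \<longrightarrow> (\<exists>v' p'. A' 5 i = int v' \<and> A' 6 i = int p' \<and> v' < n \<and> p' < n \<and>
        v' \<noteq> p' \<and> v' \<notin> V - {v} \<and> (\<forall>j<i. k \<le> j \<longrightarrow> A' 5 j \<noteq> int v' \<and> A' 6 j \<noteq> int v'))"
    proof clarify
      fix i assume i: "i < m" "k \<le> i"
      show "\<exists>v' p'. A' 5 i = int v' \<and> A' 6 i = int p' \<and> v' < n \<and> p' < n \<and>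
        v' \<noteq> p' \<and> v' \<notin> V - {v} \<and> (\<forall>j<i. k \<le> j \<longrightarrow> A' 5 j \<noteq> int v' \<and> A' 6 j \<noteq> int v')"
      proof (cases "i = k")
        case True
        then show ?thesis using v(1) E'(3,4) V
          by (intro exI[of _ v] exI[of _ p]) (auto simp: A')
      next
        case False
        then obtain v' p' where "A 5 i = int v'" "A 6 i = int p'" "v' < n" "p' < n" "v' \<noteq> p'"
          "v' \<notin> V" "\<forall>j<i. Suc k \<le> j \<longrightarrow> A 5 j \<noteq> int v' \<and> A 6 j \<noteq> int v'"
          using ord[of i] i by auto
        then show ?thesis using False vV E'(3)
          by (intro exI[of _ v'] exI[of _ p']) (auto simp: A')
      qed
    qed
    moreover have "dsum f es u = dsum f E' u +
        (\<Sum>i\<in>{k..<m}. dart f (nat (A' 5 i), nat (A' 6 i), A' 7 i, A' 8 i) u)" for f u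
    proof -
      have "(\<Sum>i\<in>{Suc k..<m}. dart f (nat (A' 5 i), nat (A' 6 i), A' 7 i, A' 8 i) u) =
          (\<Sum>i\<in>{Suc k..<m}. dart f (nat (A 5 i), nat (A 6 i), A 7 i, A 8 i) u)"
        by (intro sum.cong) (auto simp: A')
      moreover have "dart f (nat (A' 5 k), nat (A' 6 k), A' 7 k, A' 8 k) u = dart f (v, p, a, b) u"
        by (simp add: A')
      ultimately show ?thesis unfolding split ds E'(1) by simp
    qed
    moreover have "(\<forall>j<n. A 1 j \<noteq> 1 \<longrightarrow> j \<noteq> p \<longrightarrow> A' 1 j \<noteq> 1) \<and> A' 1 v \<noteq> 1"
      using E'(4) by (auto simp: A')
    ultimately show ?thesis using tree' V m unfolding strip_inv_def k by auto
  qed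
  then show thesis using that[of E' p a b "V - {v}"] k A E'(3,4) V by blast
qed

lemma strip_inv_scan:
  assumes "strip_inv n m es E V A" "E \<noteq> []"
  shows "\<exists>j<n. A 1 j = 1"
  using tree_leaf[of V E] assms unfolding strip_inv_def stats_def by fastforce

lemma strip_spec:
  assumes base: "base_regs n R" and stats: "stats {..<n} es A" and tree: "is_tree_game n es"
  shows "wpt strip (1000 * n) (\<lambda>(R', A'). base_regs n R' \<and>
    (\<exists>V. strip_inv n (n - 1) es [] V A')) (R, A)"
proof -
  have n: "n \<ge> 1" "length es = n - 1" using tree by (auto simp: is_tree_game_def)
  \<comment> \<open>From the scan pointer \<open>J\<close> on, every vertex except the current
    \<open>v\<close> is known not to be a leaf. Each round either removes an edge or lowers
    \<open>J\<close>, so \<open>length E + J\<close> bounds the remaining rounds.\<close>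
  define Inv where "Inv i s \<longleftrightarrow> base_regs n (fst s) \<and>
    (\<exists>E V J v. strip_inv n (n - 1) es E V (snd s) \<and> fst s 20 = int (length E) \<and>
       fst s 21 = int J \<and> J \<le> n \<and> fst s 22 = int v \<and> v < n \<and>
       (\<forall>j<n. J \<le> j \<longrightarrow> j \<noteq> v \<longrightarrow> snd s 1 j \<noteq> 1) \<and> i = length E + J)" for i s
  have InvI: "Inv (length E + J) (R, A)" if "base_regs n R" "strip_inv n (n - 1) es E V A"
    "R 20 = int (length E)" "R 21 = int J" "J \<le> n" "R 22 = int v" "v < n"
    "\<forall>j<n. J \<le> j \<longrightarrow> j \<noteq> v \<longrightarrow> A 1 j \<noteq> 1" for R A E V J v
    unfolding Inv_def fst_conv snd_conv using that by blast
  have body: "wpt strip_body 400 (\<lambda>s'. \<exists>i'<i. Inv i' s') s"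
    if inv: "Inv i s" and pos: "fst s 20 > 0" for i s
  proof -
    obtain R A where s: "s = (R, A)" by fastforce
    obtain E V J v where I: "strip_inv n (n - 1) es E V A" "R 20 = int (length E)" "R 21 = int J"
      "J \<le> n" "R 22 = int v" "v < n" "\<forall>j<n. J \<le> j \<longrightarrow> j \<noteq> v \<longrightarrow> A 1 j \<noteq> 1" "i = length E + J"
      and base: "R 8 = 1" "R 9 = 0" "base_regs n R"
      using inv unfolding s Inv_def by (auto simp: base_regs_def)
    obtain k where k: "length E = Suc k" using pos I(2) s by (cases "length E") auto
    show ?thesis
    proof (cases "A 1 v > 1")
      case True
      \<comment> \<open>At \<open>J = 0\<close> no vertex would be a leaf, yet a tree with an edge
        has one.\<close>
      have "J \<noteq> 0"
      proof
        assume "J = 0"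
        then show False using strip_inv_scan[OF I(1)] I(7) True k by fastforce
      qed
      then obtain J' where J': "J = Suc J'" by (cases J) auto
      have "\<forall>j<n. J' \<le> j \<longrightarrow> j \<noteq> J' \<longrightarrow> A 1 j \<noteq> 1" using I(7) True J' by fastforce
      then have "Inv (length E + J') (R', A)" if "R' 20 = R 20" "R' 21 = R 21 - 1" "R' 22 = R 21 - 1"
          "\<forall>r<20. R' r = R r" for R'
        using that I(1,2,3,4) base J' by (intro InvI[of R' E V A J' J']) (auto simp: base_regs_def)
      then show ?thesis unfolding s
        by (intro wpt_mono[OF strip_body_scan[of R v A]]) (use True I(5,8) base J' in auto)
    next
      case False
      obtain E' V' p a b where E': "length E' = k" "A 2 v = int p" "A 3 v = a" "A 4 v = b" "p < n"
        "p \<noteq> v" and A': "\<And>A'. A' = incr 4 p (- a) (incr 3 p (- b) (incr 2 p (- int v) (incr 1 p (- 1)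
          (put 1 v 2 (put 8 k b (put 7 k a (put 6 k (int p) (put 5 k (int v) A)))))))) \<Longrightarrow>
          strip_inv n (n - 1) es E' V' A' \<and> (\<forall>j<n. A 1 j \<noteq> 1 \<longrightarrow> j \<noteq> p \<longrightarrow> A' 1 j \<noteq> 1) \<and> A' 1 v \<noteq> 1"
        using strip_inv_leaf[OF I(1) k I(6) False] by metis
      have "Inv (k + J) (R', A')" if "R' 20 = int k" "R' 21 = R 21" "R' 22 = int p"
        "\<forall>r<20. R' r = R r" "A' = incr 4 p (- a) (incr 3 p (- b) (incr 2 p (- int v) (incr 1 p (- 1)
          (put 1 v 2 (put 8 k b (put 7 k a (put 6 k (int p) (put 5 k (int v) A))))))))" for R' A'
      proof -
        have "\<forall>j<n. J \<le> j \<longrightarrow> j \<noteq> p \<longrightarrow> A' 1 j \<noteq> 1" using A'[OF that(5)] I(7) by metis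
        moreover have "base_regs n R'" using that(4) base by (auto simp: base_regs_def)
        moreover have "strip_inv n (n - 1) es E' V' A'" using A'[OF that(5)] by blast
        ultimately show ?thesis
          using InvI[of R' E' V' A' J p] that(1-3) I(3,4) E'(1,5) by simp
      qed
      then show ?thesis unfolding s
        by (intro wpt_mono[OF strip_body_leaf[of R v A k p a b]])
           (use False I(2,5,8) k base E' in auto)
    qed
  qed
  have init: "strip_inv n (n - 1) es es {..<n} A"
    using tree_game_tree_on[OF tree] stats n by (auto simp: strip_inv_def)
  have loop: "wpt (WhileP 20 strip_body) ((n - 1 + n) * Suc 400 + 1)
      (\<lambda>s'. \<not> fst s' 20 > 0 \<and> (\<exists>i'. Inv i' s')) (R', A')" if "Inv (n - 1 + n) (R', A')" for R' A'
    by (rule wpt_While[of Inv, OF body that])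
  have "wpt strip (3 + ((n - 1 + n) * Suc 400 + 1))
      (\<lambda>s'. \<not> fst s' 20 > 0 \<and> (\<exists>i'. Inv i' s')) (R, A)"
    unfolding strip_def
  proof (rule wpt_Seq, rule wpt_wp)
    have "Inv (n - 1 + n) (R(20 := int (n - 1), 21 := int n, 22 := 0), A)"
      using InvI[of _ es "{..<n}" A n 0] init base n by (simp add: base_regs_def)
    then show "wp (AddR 20 15 9 ;; AddR 21 10 9 ;; AddR 22 9 9)
        (wpt (WhileP 20 strip_body) ((n - 1 + n) * Suc 400 + 1)
           (\<lambda>s'. \<not> fst s' 20 > 0 \<and> (\<exists>i'. Inv i' s'))) (R, A)"
      using loop base n by (simp add: base_regs_def)
  qed simp
  then show ?thesis
    by (rule wpt_mono) (use n in \<open>auto simp: Inv_def\<close>)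
qed

section \<open>The greedy test of a threshold\<close>

definition zero_body :: com where
  "zero_body = SubR 20 20 8 ;; ASt 10 20 9"

text \<open>Only strict positivity can be tested. With \<open>s\<close> the utility collected by the
  leaf and \<open>w\<close> its valuation for the neighbour, registers 26 and 27 hold
  \<open>t - s\<close> and \<open>t - s - w\<close>: a positive 27 rejects the edge, otherwise a
  positive 26 accepts it, otherwise the neighbour's valuation decides. \<open>SetC 27 0\<close>
  fills an empty branch.\<close>

definition greedy_body :: com where
  "greedy_body = SubR 20 20 8 ;; ALd 21 5 20 ;; ALd 22 6 20 ;; ALd 23 7 20 ;; ALd 24 8 20 ;;
     ALd 25 10 21 ;; SubR 26 12 25 ;; SubR 27 26 23 ;;
     IfP 27 (SetC 28 0) (IfP 26 (SetC 28 1) (IfP 24 (SetC 28 1) (SetC 28 0))) ;;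
     ASt 9 20 28 ;; IfP 28 (AInc 10 21 23 ;; AInc 10 22 24) (SetC 27 0)"

definition test_body :: com where
  "test_body = SubR 20 20 8 ;; ALd 25 10 20 ;; SubR 26 12 25 ;; IfP 26 (SetC 29 0) (SetC 27 0)"

definition check :: com where
  "check = AddR 20 10 9 ;; WhileP 20 zero_body ;; AddR 20 15 9 ;; WhileP 20 greedy_body ;;
     (SetC 29 1 ;; AddR 20 10 9) ;; WhileP 20 test_body"

lemma zero_body_spec:
  assumes "R 20 = int (Suc i)" "R 8 = 1" "R 9 = 0"
  shows "wpt zero_body 10 (\<lambda>(R', A'). R' 20 = int i \<and> (\<forall>r<20. R' r = R r) \<and>
    A' = put 10 i 0 A) (R, A)"
  by (rule wpt_wp) (use assms in \<open>simp_all add: zero_body_def\<close>)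

lemma greedy_body_spec:
  assumes "R 20 = int (Suc k)" "R 8 = 1" "R 12 = t"
    and "A 5 k = int v" "A 6 k = int p" "A 7 k = a" "A 8 k = b"
  shows "wpt greedy_body 100 (\<lambda>(R', A'). R' 20 = int k \<and> (\<forall>r<20. R' r = R r) \<and>
    A' = (if t \<le> A 10 v + a \<and> (A 10 v < t \<or> b > 0)
      then incr 10 p b (incr 10 v a (put 9 k 1 A)) else put 9 k 0 A)) (R, A)"
  by (rule wpt_wp) (use assms in \<open>auto simp: greedy_body_def\<close>)

lemma test_body_spec:
  assumes "R 20 = int (Suc i)" "R 8 = 1" "R 12 = t"
  shows "wpt test_body 20 (\<lambda>(R', A'). R' 20 = int i \<and> (\<forall>r<20. R' r = R r) \<and>
    R' 29 = (if A 10 i < t then 0 else R 29) \<and> A' = A) (R, A)"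
  by (rule wpt_wp) (use assms in \<open>auto simp: test_body_def\<close>)

context elimination
begin

definition order_arrays :: "(nat \<Rightarrow> nat \<Rightarrow> int) \<Rightarrow> bool" where
  "order_arrays A \<longleftrightarrow>
     (\<forall>k<m. A 5 k = int (v k) \<and> A 6 k = int (p k) \<and> A 7 k = a k \<and> A 8 k = b k)"

text \<open>Array 9 is the certificate: the labels are later computed from it and not from the
  utilities in array 10.\<close>

definition achieves :: "(nat \<Rightarrow> nat \<Rightarrow> int) \<Rightarrow> int \<Rightarrow> bool" where
  "achieves A t \<longleftrightarrow> (\<forall>u<n. t \<le> (\<Sum>k<m. if A 9 k > 0 then gain k u else 0))"

text \<open>Registers below 20 are preserved, so the bounds of the search survive each test.\<close>

lemma check_spec:
  assumes base: "base_regs n R" and ord: "order_arrays A" and t: "R 12 = t"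
  shows "wpt check (200 * n) (\<lambda>(R', A'). (\<forall>r<20. R' r = R r) \<and> order_arrays A' \<and>
    (R' 29 > 0 \<longleftrightarrow> feasible t) \<and> (feasible t \<longrightarrow> achieves A' t)) (R, A)"
proof -
  have R: "R 8 = 1" "R 9 = 0" "R 10 = int n" "R 15 = int m"
    using base n_pos by (auto simp: base_regs_def m_eq)
  define same where "same R' A' \<longleftrightarrow> (\<forall>r<20. R' r = R r) \<and> order_arrays A'" for R' A'
  have same: "R' 8 = 1" "R' 9 = 0" "R' 10 = int n" "R' 15 = int m" "R' 12 = t" "order_arrays A'"
    if "same R' A'" for R' A'
    using that R t by (auto simp: same_def)
  define I1 where "I1 i R' A' \<longleftrightarrow> same R' A' \<and> (\<forall>u<n. i \<le> u \<longrightarrow> A' 10 u = 0)" for i R' A'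
  define I2 where "I2 i R' A' \<longleftrightarrow> same R' A' \<and> i \<le> m \<and> greedy_inv t i (\<lambda>k. A' 9 k > 0) (A' 10)"
    for i R' A'
  define I3 where "I3 i R' A' \<longleftrightarrow> i \<le> n \<and> I2 0 R' A' \<and> (R' 29 > 0 \<longleftrightarrow> (\<forall>u<n. i \<le> u \<longrightarrow> t \<le> A' 10 u))"
    for i R' A'
  have l1: "wpt (WhileP 20 zero_body) (n * Suc 10 + 1) (\<lambda>(R', A'). I1 0 R' A') (R', A')"
    if "I1 n R' A'" "R' 20 = int n" for R' A'
  proof (rule wpt_countdown[of I1])
    fix i R1 A1 assume 1: "I1 (Suc i) R1 A1" "R1 20 = int (Suc i)"
    then have "R1 8 = 1" "R1 9 = 0" using same by (auto simp: I1_def)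
    then show "wpt zero_body 10 (\<lambda>(R2, A2). R2 20 = int i \<and> I1 i R2 A2) (R1, A1)"
      using 1 by (intro wpt_mono[OF zero_body_spec[of R1 i A1]])
        (auto simp: I1_def same_def order_arrays_def Suc_le_eq le_less)
  qed (use that in auto)
  have l2: "wpt (WhileP 20 greedy_body) (m * Suc 100 + 1) (\<lambda>(R', A'). I2 0 R' A') (R', A')"
    if "I2 m R' A'" "R' 20 = int m" for R' A'
  proof (rule wpt_countdown[of I2])
    fix k R1 A1 assume 1: "I2 (Suc k) R1 A1" "R1 20 = int (Suc k)"
    then have k: "k < m" and g: "greedy_inv t (Suc k) (\<lambda>k. A1 9 k > 0) (A1 10)"
      and s: "same R1 A1" by (auto simp: I2_def)
    have o: "A1 5 k = int (v k)" "A1 6 k = int (p k)" "A1 7 k = a k" "A1 8 k = b k"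
      using same(6)[OF s] k by (auto simp: order_arrays_def)
    have "I2 k R2 A2" if R2: "\<forall>r<20. R2 r = R1 r" and A2:
      "A2 = (if pick t k (A1 10)
        then incr 10 (p k) (b k) (incr 10 (v k) (a k) (put 9 k 1 A1)) else put 9 k 0 A1)" for R2 A2
    proof -
      have "A2 10 = (if pick t k (A1 10) then (\<lambda>u. A1 10 u + gain k u) else A1 10)"
        using v_neq_p[OF k] by (auto simp: A2 gain_def)
      moreover have "(\<lambda>k. A2 9 k > 0) = (\<lambda>k. A1 9 k > 0)(k := pick t k (A1 10))"
        by (auto simp: A2)
      moreover have "same R2 A2" using s R2 by (auto simp: same_def order_arrays_def A2)
      ultimately show ?thesis
        using greedy_inv_step[OF g k] k by (simp add: I2_def)
    qed
    then show "wpt greedy_body 100 (\<lambda>(R2, A2). R2 20 = int k \<and> I2 k R2 A2) (R1, A1)"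
      using 1 same[OF s] o
      by (intro wpt_mono[OF greedy_body_spec[of R1 k t A1]]) (auto simp: pick_def)
  qed (use that in auto)
  have l3: "wpt (WhileP 20 test_body) (n * Suc 20 + 1) (\<lambda>(R', A'). I3 0 R' A') (R', A')"
    if "I3 n R' A'" "R' 20 = int n" for R' A'
  proof (rule wpt_countdown[of I3])
    fix i R1 A1 assume 1: "I3 (Suc i) R1 A1" "R1 20 = int (Suc i)"
    then have s: "same R1 A1" by (simp add: I3_def I2_def)
    have "(\<forall>u<n. i \<le> u \<longrightarrow> t \<le> A1 10 u) \<longleftrightarrow>
        (i < n \<longrightarrow> t \<le> A1 10 i) \<and> (\<forall>u<n. Suc i \<le> u \<longrightarrow> t \<le> A1 10 u)"
      by (metis Suc_le_eq le_less order_refl)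
    then have "(if A1 10 i < t then 0 else R1 29) > 0 \<longleftrightarrow> (\<forall>u<n. i \<le> u \<longrightarrow> t \<le> A1 10 u)"
      using 1(1) by (auto simp: I3_def Suc_le_eq)
    then have "I3 i R2 A1"
      if "\<forall>r<20. R2 r = R1 r" "R2 29 = (if A1 10 i < t then 0 else R1 29)" for R2
      using 1(1) that unfolding I3_def I2_def same_def by simp
    then show "wpt test_body 20 (\<lambda>(R2, A2). R2 20 = int i \<and> I3 i R2 A2) (R1, A1)"
      using 1 same[OF s] by (intro wpt_mono[OF test_body_spec[of R1 i t A1]]) auto
  qed (use that in auto)
  have "wpt check (1 + ((n * Suc 10 + 1) + (1 + ((m * Suc 100 + 1) + (2 + (n * Suc 20 + 1))))))
      (\<lambda>(R', A'). I3 0 R' A') (R, A)"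
    unfolding check_def
  proof (intro wpt_SeqI)
    show "wpt (AddR 20 10 9) 1 (\<lambda>(R', A'). I1 n R' A' \<and> R' 20 = int n) (R, A)"
      by (rule wpt_wp) (use R ord in \<open>auto simp: I1_def same_def\<close>)
    show "wpt (AddR 20 15 9) 1 (\<lambda>(R', A'). I2 m R' A' \<and> R' 20 = int m) (R', A')"
      if "case (R', A') of (R', A') \<Rightarrow> I1 0 R' A'" for R' A'
      by (rule wpt_wp)
         (use that same[of R' A'] in \<open>auto simp: I1_def I2_def same_def intro: greedy_inv_start\<close>)
    show "wpt (SetC 29 1 ;; AddR 20 10 9) 2 (\<lambda>(R', A'). I3 n R' A' \<and> R' 20 = int n) (R', A')"
      if "case (R', A') of (R', A') \<Rightarrow> I2 0 R' A'" for R' A'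
      by (rule wpt_wp) (use that same[of R' A'] in \<open>auto simp: I3_def I2_def same_def\<close>)
  qed (use l1 l2 l3 in auto)
  then show ?thesis
  proof (rule wpt_mono)
    fix s' assume "case s' of (R', A') \<Rightarrow> I3 0 R' A'"
    then obtain R' A' where s': "s' = (R', A')" and I: "I3 0 R' A'" by (cases s') auto
    have g: "greedy_inv t 0 (\<lambda>k. A' 9 k > 0) (A' 10)" using I by (simp add: I3_def I2_def)
    have "achieves A' t" if "feasible t"
      using g greedy_inv_feasible[OF g] that
      by (simp add: greedy_inv_def achieves_def atLeast0LessThan)
    then show "case s' of (R', A') \<Rightarrow> (\<forall>r<20. R' r = R r) \<and> order_arrays A' \<and>
        (R' 29 > 0 \<longleftrightarrow> feasible t) \<and> (feasible t \<longrightarrow> achieves A' t)"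
      using I greedy_inv_feasible[OF g] by (auto simp: s' I3_def I2_def same_def)
  qed (use n_pos m_eq in auto)
qed

end

section \<open>Searching the optimum and labelling the coalitions\<close>

definition raise_body :: com where
  "raise_body = AddR 12 12 12 ;; check"

definition bisect_body :: com where
  "bisect_body = (AddR 12 13 14 ;; HalfR 12 12) ;; check ;;
     (IfP 29 (AddR 13 12 9) (AddR 14 12 9) ;; SubR 30 14 13 ;; SubR 30 30 8)"

text \<open>Doubling yields an infeasible upper bound without computing W, and 0 is a feasible lower
  bound. As the upper bound is a power of two, so is the length of every interval, and halving is
  exact. The closing test at the lower bound restores the kept edges in array 9, because the last
  test of the bisection may have been made at an infeasible threshold.\<close>

definition search :: com where
  "search = SetC 12 1 ;; check ;; WhileP 29 raise_body ;;
     (SetC 13 0 ;; AddR 14 12 9 ;; SubR 30 14 13 ;; SubR 30 30 8) ;; WhileP 30 bisect_body ;;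
     AddR 12 13 9 ;; check"

text \<open>Labelling needs the reverse of the stripping order, so register 20 runs upwards through
  the edges, while register 21 counts down as the loop guard.\<close>

definition label_body :: com where
  "label_body = SubR 21 21 8 ;; ALd 22 5 20 ;; ALd 23 6 20 ;; ALd 24 9 20 ;;
     IfP 24 (ALd 25 11 23 ;; ASt 11 22 25) (SetC 25 0) ;; AddR 20 20 8"

definition label_init_body :: com where
  "label_init_body = SubR 20 20 8 ;; ASt 11 20 20"

definition label :: com where
  "label = AddR 20 10 9 ;; WhileP 20 label_init_body ;;
     (AddR 20 9 9 ;; AddR 21 15 9) ;; WhileP 21 label_body"

lemma label_init_body_spec:
  assumes "R 20 = int (Suc i)" "R 8 = 1"
  shows "wpt label_init_body 10 (\<lambda>(R', A'). R' 20 = int i \<and> (\<forall>r<20. R' r = R r) \<and>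
    A' = put 11 i (int i) A) (R, A)"
  by (rule wpt_wp) (use assms in \<open>simp_all add: label_init_body_def\<close>)

lemma label_body_spec:
  assumes "R 21 = int (Suc i)" "R 20 = int k" "R 8 = 1" "A 5 k = int v" "A 6 k = int p"
  shows "wpt label_body 60 (\<lambda>(R', A'). R' 21 = int i \<and> R' 20 = int (Suc k) \<and>
    (\<forall>r<20. R' r = R r) \<and> A' = (if A 9 k > 0 then put 11 v (A 11 p) A else A)) (R, A)"
  by (rule wpt_wp) (use assms in \<open>auto simp: label_body_def\<close>)

context elimination
begin

lemma search_spec:
  assumes base: "base_regs n R" and ord: "order_arrays A" and W: "Wmax n es < 2 ^ L"
  shows "wpt search (1000 * n * (L + 1)) (\<lambda>(R', A'). base_regs n R' \<and> order_arrays A' \<and>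
    (\<exists>t. achieves A' t \<and> \<not> feasible (t + 1))) (R, A)"
proof -
  define Inv1 where "Inv1 i s \<longleftrightarrow> base_regs n (fst s) \<and> order_arrays (snd s) \<and>
    (\<exists>j. fst s 12 = 2 ^ j \<and> L = i + j \<and> (fst s 29 > 0 \<longleftrightarrow> feasible (2 ^ j)))" for i s
  define Inv2 where "Inv2 i s \<longleftrightarrow> base_regs n (fst s) \<and> order_arrays (snd s) \<and> i \<le> L \<and>
    fst s 14 = fst s 13 + 2 ^ i \<and> feasible (fst s 13) \<and> \<not> feasible (fst s 14) \<and>
    fst s 30 = 2 ^ i - 1" for i s
  have check: "wpt check (200 * n) Q (R1, A1)"
    if "base_regs n R1" "order_arrays A1"
      "\<And>R2 A2. \<forall>r<20. R2 r = R1 r \<Longrightarrow> order_arrays A2 \<Longrightarrow> base_regs n R2 \<Longrightarrow>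
        (R2 29 > 0 \<longleftrightarrow> feasible (R1 12)) \<Longrightarrow> (feasible (R1 12) \<longrightarrow> achieves A2 (R1 12)) \<Longrightarrow> Q (R2, A2)"
    for R1 A1 Q
  proof (rule wpt_mono[OF check_spec[OF that(1,2) refl]])
    fix s' assume "case s' of (R', A') \<Rightarrow> (\<forall>r<20. R' r = R1 r) \<and> order_arrays A' \<and>
      (R' 29 > 0 \<longleftrightarrow> feasible (R1 12)) \<and> (feasible (R1 12) \<longrightarrow> achieves A' (R1 12))"
    then obtain R2 A2 where 1: "s' = (R2, A2)" "\<forall>r<20. R2 r = R1 r" "order_arrays A2"
      "R2 29 > 0 \<longleftrightarrow> feasible (R1 12)" "feasible (R1 12) \<longrightarrow> achieves A2 (R1 12)"
      by (cases s') auto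
    have "base_regs n R2" using that(1) 1(2) by (simp add: base_regs_def)
    then show "Q s'" unfolding 1(1) using that(3) 1(2-5) by blast
  qed simp
  have b1: "wpt raise_body (1 + 200 * n) (\<lambda>s'. \<exists>i'<i. Inv1 i' s') s"
    if inv: "Inv1 i s" and pos: "fst s 29 > 0" for i s
  proof -
    obtain j where j: "fst s 12 = 2 ^ j" "L = i + j" "feasible (2 ^ j)"
      using inv pos by (auto simp: Inv1_def)
    \<comment> \<open>A feasible \<open>2 ^ j\<close> is at most W and hence below
      \<open>2 ^ L\<close>, so one more doubling stays within the budget of
      \<open>L\<close>.\<close>
    have "(2::int) ^ j < 2 ^ L" using feasible_Wmax[OF j(3)] W by (rule le_less_trans)
    then obtain i' where i': "i = Suc i'" using j(2) by (cases i) auto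
    show ?thesis
      unfolding raise_body_def
    proof (rule wpt_Seq, rule wpt_wp)
      let ?R = "(fst s)(12 := 2 ^ Suc j)"
      have "wpt check (200 * n) (\<lambda>s'. \<exists>i'<i. Inv1 i' s') (?R, snd s)"
      proof (rule check)
        fix R2 A2 assume 1: "\<forall>r<20. R2 r = ?R r" "order_arrays A2" "base_regs n R2"
          "R2 29 > 0 \<longleftrightarrow> feasible (?R 12)"
        have "Inv1 i' (R2, A2)" unfolding Inv1_def fst_conv snd_conv using 1 j i'
          by (intro conjI exI[of _ "Suc j"]) simp_all
        then show "\<exists>i'<i. Inv1 i' (R2, A2)" using i' by blast
      qed (use inv in \<open>auto simp: Inv1_def base_regs_def\<close>)
      then show "wp (AddR 12 12 12) (wpt check (200 * n) (\<lambda>s'. \<exists>i'<i. Inv1 i' s')) s"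
        using j(1) by (cases s) simp
    qed simp
  qed
  have b2: "wpt bisect_body (10 + 200 * n) (\<lambda>s'. \<exists>i'<i. Inv2 i' s') s"
    if inv: "Inv2 i s" and pos: "fst s 30 > 0" for i s
  proof -
    obtain R1 A1 where s: "s = (R1, A1)" by fastforce
    have i: "i \<noteq> 0"
    proof
      assume "i = 0"
      then show False using inv pos by (simp add: Inv2_def)
    qed
    then obtain i' where i': "i = Suc i'" by (cases i) auto
    have R1: "base_regs n R1" "order_arrays A1" "i \<le> L" "R1 14 = R1 13 + 2 ^ i"
      "feasible (R1 13)" "\<not> feasible (R1 14)"
      using inv by (auto simp: Inv2_def s)
    have mid: "(R1 13 + R1 14) div 2 = R1 13 + 2 ^ i'" unfolding R1(4) i' by simp
    let ?R = "R1(12 := R1 13 + 2 ^ i')"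
    have "wpt bisect_body (2 + (200 * n + 6)) (\<lambda>s'. \<exists>i'<i. Inv2 i' s') s"
      unfolding bisect_body_def
    proof (rule wpt_Seq, rule wpt_wp)
      have "wpt (check ;; (IfP 29 (AddR 13 12 9) (AddR 14 12 9) ;; SubR 30 14 13 ;; SubR 30 30 8))
        (200 * n + 6) (\<lambda>s'. \<exists>i'<i. Inv2 i' s') (?R, A1)"
      proof (rule wpt_Seq, rule check)
        fix R2 A2 assume 1: "\<forall>r<20. R2 r = ?R r" "order_arrays A2" "base_regs n R2"
          "R2 29 > 0 \<longleftrightarrow> feasible (?R 12)"
        have R2: "R2 8 = 1" "R2 9 = 0" "R2 12 = R1 13 + 2 ^ i'" "R2 13 = R1 13" "R2 14 = R1 13 + 2 ^ i"
          using 1(1,3) R1 by (simp_all add: base_regs_def)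
        show "wpt (IfP 29 (AddR 13 12 9) (AddR 14 12 9) ;; SubR 30 14 13 ;; SubR 30 30 8) 6
          (\<lambda>s'. \<exists>i'<i. Inv2 i' s') (R2, A2)"
        proof (rule wpt_wp)
          show "wp (IfP 29 (AddR 13 12 9) (AddR 14 12 9) ;; SubR 30 14 13 ;; SubR 30 30 8)
            (\<lambda>s'. \<exists>i'<i. Inv2 i' s') (R2, A2)"
            using R2 1 R1 by (auto simp: i' Inv2_def base_regs_def intro!: exI[of _ i'])
        qed simp
      qed (use R1 in \<open>auto simp: base_regs_def\<close>)
      then show "wp (AddR 12 13 14 ;; HalfR 12 12) (wpt (check ;; (IfP 29 (AddR 13 12 9) (AddR 14 12 9) ;;
        SubR 30 14 13 ;; SubR 30 30 8)) (200 * n + 6) (\<lambda>s'. \<exists>i'<i. Inv2 i' s')) s"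
        using mid by (simp add: s)
    qed simp
    then show ?thesis by (rule wpt_mono) auto
  qed
  have l1: "wpt (WhileP 29 raise_body) (L * Suc (1 + 200 * n) + 1)
      (\<lambda>s'. \<not> fst s' 29 > 0 \<and> (\<exists>i'. Inv1 i' s')) s" if "Inv1 L s" for s
    by (rule wpt_While[of Inv1, OF b1 that])
  have l2: "wpt (WhileP 30 bisect_body) (L * Suc (10 + 200 * n) + 1)
      (\<lambda>s'. \<not> fst s' 30 > 0 \<and> (\<exists>i'. Inv2 i' s')) s" if ex: "\<exists>i\<le>L. Inv2 i s" for s
  proof -
    obtain i where i: "i \<le> L" "Inv2 i s" using ex by blast
    show ?thesis
      by (rule wpt_mono[OF wpt_While[of Inv2, OF b2 i(2)]]) (use i(1) in auto)
  qed
  have "wpt search (1 + (200 * n + ((L * Suc (1 + 200 * n) + 1) + (4 +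
      ((L * Suc (10 + 200 * n) + 1) + (1 + 200 * n)))))) (\<lambda>(R', A'). base_regs n R' \<and> order_arrays A' \<and>
    (\<exists>t. achieves A' t \<and> \<not> feasible (t + 1))) (R, A)"
    unfolding search_def
  proof (intro wpt_SeqI)
    show "wpt (SetC 12 1) 1 (\<lambda>(R', A'). base_regs n R' \<and> order_arrays A' \<and> R' 12 = 1) (R, A)"
      by (rule wpt_wp) (use base ord in \<open>auto simp: base_regs_def\<close>)
    show "wpt check (200 * n) (Inv1 L) (R1, A1)"
      if "case (R1, A1) of (R', A') \<Rightarrow> base_regs n R' \<and> order_arrays A' \<and> R' 12 = 1" for R1 A1
      by (rule check) (use that in \<open>auto simp: Inv1_def intro!: exI[of _ 0]\<close>)
    show "wpt (WhileP 29 raise_body) (L * Suc (1 + 200 * n) + 1)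
      (\<lambda>s'. \<not> fst s' 29 > 0 \<and> (\<exists>i'. Inv1 i' s')) (R1, A1)" if "Inv1 L (R1, A1)" for R1 A1
      using l1 that .
    show "wpt (SetC 13 0 ;; AddR 14 12 9 ;; SubR 30 14 13 ;; SubR 30 30 8) 4 (\<lambda>s. \<exists>i\<le>L. Inv2 i s)
      (R1, A1)" if inv: "\<not> fst (R1, A1) 29 > 0 \<and> (\<exists>i'. Inv1 i' (R1, A1))" for R1 A1
    proof (rule wpt_wp)
      obtain j where j: "R1 12 = 2 ^ j" "j \<le> L" "\<not> feasible (2 ^ j)" "base_regs n R1" "order_arrays A1"
        using inv by (auto simp: Inv1_def)
      have "Inv2 j (R1(13 := 0, 14 := 2 ^ j, 30 := 2 ^ j - 1), A1)"
        using j feasible_0 by (auto simp: Inv2_def base_regs_def)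
      then show "wp (SetC 13 0 ;; AddR 14 12 9 ;; SubR 30 14 13 ;; SubR 30 30 8) (\<lambda>s. \<exists>i\<le>L. Inv2 i s)
        (R1, A1)" using j by (auto simp: base_regs_def)
    qed simp
    show "wpt (WhileP 30 bisect_body) (L * Suc (10 + 200 * n) + 1)
      (\<lambda>s'. \<not> fst s' 30 > 0 \<and> (\<exists>i'. Inv2 i' s')) (R1, A1)" if "\<exists>i\<le>L. Inv2 i (R1, A1)" for R1 A1
      using l2 that .
    show "wpt (AddR 12 13 9) 1 (\<lambda>(R', A'). base_regs n R' \<and> order_arrays A' \<and>
      feasible (R' 12) \<and> \<not> feasible (R' 12 + 1)) (R1, A1)"
      if inv: "\<not> fst (R1, A1) 30 > 0 \<and> (\<exists>i'. Inv2 i' (R1, A1))" for R1 A1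
    proof (rule wpt_wp)
      obtain i where i: "Inv2 i (R1, A1)" using inv by blast
      \<comment> \<open>Register 30 holds the interval length minus 1. Once it is not positive the
        length is 1, so the infeasible bound is the successor of the feasible one.\<close>
      then have "(2::int) ^ i \<le> 1" using inv by (simp add: Inv2_def)
      moreover have "(2::int) ^ 1 \<le> 2 ^ i" if "i \<noteq> 0" using that by (intro power_increasing) auto
      ultimately have "i = 0" by fastforce
      then show "wp (AddR 12 13 9) (\<lambda>(R', A'). base_regs n R' \<and> order_arrays A' \<and>
        feasible (R' 12) \<and> \<not> feasible (R' 12 + 1)) (R1, A1)"
        using i by (auto simp: Inv2_def base_regs_def)
    qed simp
    show "wpt check (200 * n) (\<lambda>(R', A'). base_regs n R' \<and> order_arrays A' \<and>
      (\<exists>t. achieves A' t \<and> \<not> feasible (t + 1))) (R1, A1)"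
      if "case (R1, A1) of (R', A') \<Rightarrow> base_regs n R' \<and> order_arrays A' \<and>
        feasible (R' 12) \<and> \<not> feasible (R' 12 + 1)" for R1 A1
      by (rule check) (use that in auto)
  qed
  then show ?thesis
  proof (rule wpt_mono)
    \<comment> \<open>Besides \<open>400 * n * (L + 1)\<close> the search spends
      \<open>8 + 13 * L\<close>, which the remaining \<open>600 * n * (L + 1)\<close>
      absorbs.\<close>
    have "8 \<le> n * 600" "L * 13 \<le> L * (n * 600)"
      using n_pos by (simp, intro mult_le_mono2, simp)
    then have "8 + L * 13 \<le> n * 600 + L * (n * 600)" by (rule add_mono)
    then show "1 + (200 * n + ((L * Suc (1 + 200 * n) + 1) + (4 +
      ((L * Suc (10 + 200 * n) + 1) + (1 + 200 * n))))) \<le> 1000 * n * (L + 1)"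
      by (simp add: algebra_simps)
  qed
qed

lemma label_spec:
  assumes base: "base_regs n R" and ord: "order_arrays A"
  shows "wpt label (100 * n) (\<lambda>(R', A'). base_regs n R' \<and>
    lab_inv m (\<lambda>k. A 9 k > 0) (A' 11)) (R, A)"
proof -
  define I1 where "I1 i R' A' \<longleftrightarrow> base_regs n R' \<and> (\<forall>c. c \<noteq> 11 \<longrightarrow> A' c = A c) \<and>
    (\<forall>u<n. i \<le> u \<longrightarrow> A' 11 u = int u)" for i R' A'
  define I2 where "I2 i R' A' \<longleftrightarrow> base_regs n R' \<and> (\<forall>c. c \<noteq> 11 \<longrightarrow> A' c = A c) \<and> i \<le> m \<and>
    R' 20 = int (m - i) \<and> lab_inv (m - i) (\<lambda>k. A 9 k > 0) (A' 11)" for i R' A'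
  have l1: "wpt (WhileP 20 label_init_body) (n * Suc 10 + 1) (\<lambda>(R', A'). I1 0 R' A') (R', A')"
    if "I1 n R' A'" "R' 20 = int n" for R' A'
  proof (rule wpt_countdown[of I1])
    fix i R1 A1 assume 1: "I1 (Suc i) R1 A1" "R1 20 = int (Suc i)"
    then have "R1 8 = 1" by (auto simp: I1_def base_regs_def)
    then show "wpt label_init_body 10 (\<lambda>(R2, A2). R2 20 = int i \<and> I1 i R2 A2) (R1, A1)"
      using 1 by (intro wpt_mono[OF label_init_body_spec[of R1 i A1]])
        (auto simp: I1_def base_regs_def Suc_le_eq le_less)
  qed (use that in auto)
  have l2: "wpt (WhileP 21 label_body) (m * Suc 60 + 1) (\<lambda>(R', A'). I2 0 R' A') (R', A')"
    if "I2 m R' A'" "R' 21 = int m" for R' A'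
  proof (rule wpt_countdown[of I2])
    fix i R1 A1 assume 1: "I2 (Suc i) R1 A1" "R1 21 = int (Suc i)"
    define k where "k = m - Suc i"
    have k: "k < m" "m - i = Suc k" "R1 20 = int k" and l: "lab_inv k (\<lambda>k. A 9 k > 0) (A1 11)"
      and A1: "\<forall>c. c \<noteq> 11 \<longrightarrow> A1 c = A c" and R1: "base_regs n R1"
      using 1 by (auto simp: I2_def k_def)
    have o: "A1 5 k = int (v k)" "A1 6 k = int (p k)" "A1 9 k = A 9 k"
      using ord k(1) A1 by (auto simp: order_arrays_def)
    have "I2 i R2 A2" if "R2 20 = int (Suc k)" "\<forall>r<20. R2 r = R1 r"
      "A2 = (if A1 9 k > 0 then put 11 (v k) (A1 11 (p k)) A1 else A1)" for R2 A2
    proof -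
      have "A2 11 = (if A 9 k > 0 then (A1 11)(v k := A1 11 (p k)) else A1 11)"
        by (auto simp: that(3) o(3))
      then have "lab_inv (Suc k) (\<lambda>k. A 9 k > 0) (A2 11)"
        using lab_inv_Suc[OF l k(1)] by simp
      moreover have "\<forall>c. c \<noteq> 11 \<longrightarrow> A2 c = A c" using A1 by (auto simp: that(3) fun_eq_iff)
      ultimately show ?thesis
        using that(1,2) R1 k 1(1) by (auto simp: I2_def base_regs_def)
    qed
    then show "wpt label_body 60 (\<lambda>(R2, A2). R2 21 = int i \<and> I2 i R2 A2) (R1, A1)"
      using 1(2) k(3) R1 o(1,2)
      by (intro wpt_mono[OF label_body_spec[of R1 i k A1 "v k" "p k"]]) (auto simp: base_regs_def)
  qed (use that in auto)
  have "wpt label (1 + ((n * Suc 10 + 1) + (2 + (m * Suc 60 + 1)))) (\<lambda>(R', A'). I2 0 R' A') (R, A)"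
    unfolding label_def
  proof (intro wpt_SeqI)
    show "wpt (AddR 20 10 9) 1 (\<lambda>(R', A'). I1 n R' A' \<and> R' 20 = int n) (R, A)"
      by (rule wpt_wp) (use base in \<open>auto simp: I1_def base_regs_def\<close>)
    show "wpt (AddR 20 9 9 ;; AddR 21 15 9) 2 (\<lambda>(R', A'). I2 m R' A' \<and> R' 21 = int m) (R1, A1)"
      if "case (R1, A1) of (R', A') \<Rightarrow> I1 0 R' A'" for R1 A1
      by (rule wpt_wp)
         (use that n_pos in \<open>auto simp: I1_def I2_def base_regs_def m_eq intro!: lab_inv_0\<close>)
  qed (use l1 l2 in auto)
  then show ?thesis
    by (rule wpt_mono) (use n_pos m_eq in \<open>auto simp: I2_def\<close>)
qed

end

definition main :: com where
  "main = (SetC 8 1 ;; SetC 9 0 ;; SubR 15 10 8) ;; build ;; strip ;; search ;; label"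

lemma wf_main: "wf_com main"
  by (simp add: main_def build_def clear_body_def edge_body_def strip_def strip_body_def search_def
      check_def zero_body_def greedy_body_def test_body_def raise_body_def bisect_body_def label_def
      label_init_body_def label_body_def)

text \<open>Once no edge is left, the stripping invariant describes an elimination order: each leaf
  avoids both ends of all edges stored below it, which are those stripped later.\<close>

lemma strip_inv_elimination:
  assumes tree: "is_tree_game n es" and inv: "strip_inv n (n - 1) es [] V A"
  shows "elimination n (n - 1) es (\<lambda>k. nat (A 5 k)) (\<lambda>k. nat (A 6 k)) (A 7) (A 8)"
proof
  show "n \<ge> 1" "edges_in {..<n} es"
    using tree by (auto simp: is_tree_game_def edges_in_def)
  have *: "\<exists>v p. A 5 k = int v \<and> A 6 k = int p \<and> v < n \<and> p < n \<and> v \<noteq> p \<and>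
      (\<forall>j<k. A 5 j \<noteq> int v \<and> A 6 j \<noteq> int v)" if "k < n - 1" for k
    using inv that unfolding strip_inv_def by auto
  show "nat (A 5 k) < n" "nat (A 6 k) < n" "nat (A 5 k) \<noteq> nat (A 6 k)" if "k < n - 1" for k
    using *[OF that] by auto
  show "nat (A 5 k) \<noteq> nat (A 5 j) \<and> nat (A 5 k) \<noteq> nat (A 6 j)" if "k < n - 1" "j < k" for k j
    using *[of k] *[of j] that by auto
  show "dsum f es u = (\<Sum>k<n - 1. dart f (nat (A 5 k), nat (A 6 k), A 7 k, A 8 k) u)" for f u
    using inv unfolding strip_inv_def by (simp add: atLeast0LessThan)
qed simp

lemma main_spec:
  assumes tree: "is_tree_game n es" and n: "R 10 = int n" and A: "input_array es A"
    and W: "Wmax n es < 2 ^ L"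
  shows "wpt main (3000 * n * (L + 1)) (\<lambda>(R', A'). R' 10 = int n \<and> max_egalitarian n es (A' 11)) (R, A)"
proof -
  have es: "n \<ge> 1" "edges_in {..<n} es" "length es = n - 1"
    using tree by (auto simp: is_tree_game_def edges_in_def)
  have "wpt main (3 + (300 * n + (1000 * n + (1000 * n * (L + 1) + 100 * n))))
      (\<lambda>(R', A'). R' 10 = int n \<and> max_egalitarian n es (A' 11)) (R, A)"
    unfolding main_def
  proof (rule wpt_SeqI)
    show "wpt (SetC 8 1 ;; SetC 9 0 ;; SubR 15 10 8) 3
        (\<lambda>(R', A'). base_regs n R' \<and> input_array es A') (R, A)"
      by (rule wpt_wp) (use n A in \<open>auto simp: base_regs_def\<close>)
    fix R1 A1 assume 2: "case (R1, A1) of (R', A') \<Rightarrow> base_regs n R' \<and> input_array es A'"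
    show "wpt (build ;; strip ;; search ;; label) (300 * n + (1000 * n + (1000 * n * (L + 1) + 100 * n)))
        (\<lambda>(R', A'). R' 10 = int n \<and> max_egalitarian n es (A' 11)) (R1, A1)"
    proof (rule wpt_SeqI)
      show "wpt build (300 * n) (\<lambda>(R', A'). base_regs n R' \<and> stats {..<n} es A') (R1, A1)"
        using build_spec 2 es by simp
      fix R2 A2 assume 3: "case (R2, A2) of (R', A') \<Rightarrow> base_regs n R' \<and> stats {..<n} es A'"
      show "wpt (strip ;; search ;; label) (1000 * n + (1000 * n * (L + 1) + 100 * n))
          (\<lambda>(R', A'). R' 10 = int n \<and> max_egalitarian n es (A' 11)) (R2, A2)"
      proof (rule wpt_SeqI)
        show "wpt strip (1000 * n) (\<lambda>(R', A'). base_regs n R' \<and>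
            (\<exists>V. strip_inv n (n - 1) es [] V A')) (R2, A2)"
          using strip_spec 3 tree by simp
        fix R3 A3 assume 4: "case (R3, A3) of (R', A') \<Rightarrow> base_regs n R' \<and>
            (\<exists>V. strip_inv n (n - 1) es [] V A')"
        then obtain V where V: "base_regs n R3" "strip_inv n (n - 1) es [] V A3" by auto
        interpret elimination n "n - 1" es "\<lambda>k. nat (A3 5 k)" "\<lambda>k. nat (A3 6 k)" "A3 7" "A3 8"
          by (rule strip_inv_elimination[OF tree V(2)])
        have ord: "order_arrays A3"
          using V(2) unfolding order_arrays_def strip_inv_def by fastforce
        show "wpt (search ;; label) (1000 * n * (L + 1) + 100 * n)
          (\<lambda>(R', A'). R' 10 = int n \<and> max_egalitarian n es (A' 11)) (R3, A3)"
        proof (rule wpt_SeqI[OF search_spec[OF V(1) ord W]])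
          fix R4 A4 assume "case (R4, A4) of (R', A') \<Rightarrow> base_regs n R' \<and> order_arrays A' \<and>
            (\<exists>t. achieves A' t \<and> \<not> feasible (t + 1))"
          then obtain t where 5: "base_regs n R4" "order_arrays A4" "achieves A4 t" "\<not> feasible (t + 1)"
            by auto
          show "wpt label (100 * n) (\<lambda>(R', A'). R' 10 = int n \<and> max_egalitarian n es (A' 11)) (R4, A4)"
          proof (rule wpt_mono[OF label_spec[OF 5(1,2)]])
            fix s' :: astate
            assume "case s' of (R', A') \<Rightarrow> base_regs n R' \<and> lab_inv (n - 1) (\<lambda>k. A4 9 k > 0) (A' 11)"
            then obtain R5 A5 where 6: "s' = (R5, A5)" "base_regs n R5"
              "lab_inv (n - 1) (\<lambda>k. A4 9 k > 0) (A5 11)" by (cases s') auto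
            have "\<forall>u<n. t \<le> utility n es (A5 11) u"
              using 5(3) lab_inv_utility[OF 6(3)] unfolding achieves_def by auto
            then have "max_egalitarian n es (A5 11)"
              using max_egalitarianI 5(4) by blast
            then show "case s' of (R', A') \<Rightarrow> R' 10 = int n \<and> max_egalitarian n es (A' 11)"
              using 6 by (simp add: base_regs_def)
          qed simp
        qed
      qed
    qed
  qed
  then show ?thesis
  proof (rule wpt_mono)
    show "3 + (300 * n + (1000 * n + (1000 * n * (L + 1) + 100 * n))) \<le> 3000 * n * (L + 1)"
      using es(1) by (simp add: algebra_simps)
  qed
qed

section \<open>Input and output\<close>

text \<open>Copies \<open>M 4\<close> cells from address \<open>M 2\<close> on in steps of \<open>M 3\<close> to address \<open>M 0\<close> on in steps of
  \<open>M 1\<close>. Everything fits into the cells 0, ..., 5 because the input and the output occupy the low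
  addresses.\<close>

definition copy_code :: "nat \<Rightarrow> instr list" where
  "copy_code q = [Jpos 4 (q + 2), Jmp (q + 9), Load 5 2, Store 5 0, Add 0 0 1, Add 2 2 3, Const 5 1,
     Sub 4 4 5, Jmp q]"

text \<open>Each cell costs eight instructions and the exit two. Sources and targets are disjoint,
  so no store spoils a later source. The final pointers belong to the result because the code that
  follows recovers \<open>n\<close> or the next address from the source pointer.\<close>

lemma copy_code_run:
  assumes "code_at P q (copy_code q)" "dx \<noteq> 0"
    and "M 0 = x" "M 1 = dx" "M 2 = y" "M 3 = dy" "M 4 = int c"
    and "\<And>i. i < c \<Longrightarrow> x + int i * dx \<ge> 6" "\<And>i. i < c \<Longrightarrow> y + int i * dy \<ge> 6"
    and "\<And>i j. i < c \<Longrightarrow> j < c \<Longrightarrow> x + int i * dx \<noteq> y + int j * dy"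
  shows "\<exists>M'. run P (8 * c + 2) (q, M) = (q + 9, M') \<and> M' 0 = x + int c * dx \<and>
    M' 2 = y + int c * dy \<and>
    (\<forall>i<c. M' (nat (x + int i * dx)) = M (nat (y + int i * dy))) \<and>
    (\<forall>z\<ge>6. (\<forall>i<c. z \<noteq> nat (x + int i * dx)) \<longrightarrow> M' z = M z)"
  using assms(3-)
proof (induction c arbitrary: M x y)
  case 0
  have "run P (Suc (Suc 0)) (q, M) = (q + 9, M)"
    using assms(1) 0 by (simp add: copy_code_def run_Suc run_0 step_exec1)
  then show ?case using 0 by auto
next
  case (Suc c)
  let ?v = "M (nat y)"
  define M1 where "M1 = M(nat x := ?v, 0 := x + dx, 2 := y + dy, 5 := 1, 4 := int c)"
  have xy: "x \<ge> 6" "y \<ge> 6" using Suc.prems(6,7)[of 0] by simp_all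
  define B where "B = [Load 5 2, Store 5 0, Add 0 0 1, Add 2 2 3, Const 5 1, Sub 4 4 5]"
  have B: "length B = 6" "code_at P (q + 2) B" "\<forall>i \<in> set B. straight i"
    using assms(1) by (simp_all add: B_def copy_code_def)
  have "fold exec_mem B M = M1"
    using xy Suc.prems(1-5) by (auto simp: B_def M1_def fun_eq_iff)
  then have "run P 6 (q + 2, M) = (q + 8, M1)"
    using run_straight[OF B(2,3), of M] B(1) by simp
  moreover have "P ! (q + 8) = Jmp q" "q + 8 < length P"
    using assms(1) by (simp_all add: copy_code_def eval_nat_numeral)
  then have "run P (Suc 0) (q + 8, M1) = (q, M1)" by (simp add: run_Suc run_0 step_exec1)
  moreover have "run P (Suc 0) (q, M) = (q + 2, M)"
    using assms(1) Suc.prems by (simp add: copy_code_def run_Suc run_0 step_exec1)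
  ultimately have first: "run P (Suc 0 + 6 + Suc 0) (q, M) = (q, M1)"
    unfolding run_add by simp
  have sh: "z + d + int i * d = z + int (Suc i) * d" for z d i
    by (simp add: algebra_simps)
  have "\<exists>M'. run P (8 * c + 2) (q, M1) = (q + 9, M') \<and> M' 0 = x + dx + int c * dx \<and>
    M' 2 = y + dy + int c * dy \<and>
    (\<forall>i<c. M' (nat (x + dx + int i * dx)) = M1 (nat (y + dy + int i * dy))) \<and>
    (\<forall>z\<ge>6. (\<forall>i<c. z \<noteq> nat (x + dx + int i * dx)) \<longrightarrow> M' z = M1 z)"
  proof (rule Suc.IH)
    show "M1 0 = x + dx" "M1 1 = dx" "M1 2 = y + dy" "M1 3 = dy" "M1 4 = int c"
      using xy Suc.prems by (auto simp: M1_def)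
    show "x + dx + int i * dx \<ge> 6" "y + dy + int i * dy \<ge> 6" if "i < c" for i
      unfolding sh using Suc.prems(6,7)[of "Suc i"] that by auto
    show "x + dx + int i * dx \<noteq> y + dy + int j * dy" if "i < c" "j < c" for i j
      unfolding sh using Suc.prems(8)[of "Suc i" "Suc j"] that by auto
  qed
  then obtain M' where M': "run P (8 * c + 2) (q, M1) = (q + 9, M')" "M' 0 = x + int (Suc c) * dx"
    "M' 2 = y + int (Suc c) * dy"
    "\<And>i. i < c \<Longrightarrow> M' (nat (x + int (Suc i) * dx)) = M1 (nat (y + int (Suc i) * dy))"
    "\<And>z. z \<ge> 6 \<Longrightarrow> (\<And>i. i < c \<Longrightarrow> z \<noteq> nat (x + int (Suc i) * dx)) \<Longrightarrow> M' z = M1 z"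
    unfolding sh by blast
  have "8 * Suc c + 2 = (Suc 0 + 6 + Suc 0) + (8 * c + 2)" by simp
  then have "run P (8 * Suc c + 2) (q, M) = (q + 9, M')"
    using first M'(1) by (simp only: run_add)
  moreover have M1: "M1 z = (if z = nat x then ?v else M z)" if "z \<ge> 6" for z
    using that xy by (auto simp: M1_def)
  have "M' (nat (x + int i * dx)) = M (nat (y + int i * dy))" if "i < Suc c" for i
  proof (cases i)
    case 0
    \<comment> \<open>The first target is written only once, since a nonzero step leads to other
      addresses.\<close>
    have "nat x \<noteq> nat (x + int (Suc j) * dx)" if "j < c" for j
    proof -
      define e where "e = x + int (Suc j) * dx"
      have "e \<noteq> x" "e \<ge> 6" using assms(2) Suc.prems(6)[of "Suc j"] that by (auto simp: e_def)
      then show ?thesis using xy unfolding e_def[symmetric] by auto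
    qed
    then have "M' (nat x) = M1 (nat x)" using xy by (intro M'(5)) auto
    then show ?thesis using 0 M1[of "nat x"] xy by auto
  next
    case (Suc j)
    have "y + int (Suc j) * dy \<ge> 6" "y + int (Suc j) * dy \<noteq> x"
      using that Suc Suc.prems(7)[of "Suc j"] Suc.prems(8)[of 0 "Suc j"] by auto
    then show ?thesis using that Suc M'(4)[of j] xy M1[of "nat (y + int (Suc j) * dy)"] by auto
  qed
  moreover have "M' z = M z" if "z \<ge> 6" "\<forall>i<Suc c. z \<noteq> nat (x + int i * dx)" for z
  proof -
    have "M' z = M1 z" using that by (intro M'(5)) auto
    then show ?thesis using M1[OF that(1)] that(2)[rule_format, of 0] by simp
  qed
  ultimately show ?case using M'(2,3) by blast
qed

text \<open>Cells 1 to 5 are saved one by one to free them for the copy loop. Six doublings turn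
  \<open>n\<close> into the base \<open>64 * n\<close>, which lies beyond all input cells. Cell 4
  receives \<open>8 * n\<close>, more than the \<open>4 * n - 4\<close> input values; it is obtained
  by halving the base, because \<open>n\<close> itself is no longer stored.\<close>

definition prologue1 :: "instr list" where
  "prologue1 = [Add 0 0 0, Add 0 0 0, Add 0 0 0, Add 0 0 0, Add 0 0 0, Add 0 0 0, Store 1 0, Const 1 16, Add 0 0 1, Store 2 0, Add 0 0 1,
     Store 3 0, Add 0 0 1, Store 4 0, Add 0 0 1, Store 5 0, Add 0 0 1,
     Const 5 80, Sub 4 0 5, Half 4 4, Half 4 4, Half 4 4, Const 2 6, Const 3 1]"

text \<open>The source pointer stops at \<open>6 + 8 * n\<close>, which gives back \<open>n\<close>
  by three halvings and the base by three doublings.\<close>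

definition prologue2 :: "instr list" where
  "prologue2 = [Const 5 6, Sub 10 2 5, Add 60 10 10, Add 60 60 60, Add 60 60 60,
     Half 10 10, Half 10 10, Half 10 10]"

definition prologue :: "instr list" where
  "prologue = prologue1 @ copy_code 24 @ prologue2"

lemma length_prologue: "length prologue = 41"
  by (simp add: prologue_def prologue1_def copy_code_def prologue2_def)

lemma save_cell:
  assumes "M 0 = int d" "d \<ge> 64" "j \<le> 5"
  shows "fold exec_mem [Store j 0, Add 0 0 1] M = M(d := M j, 0 := int d + M 1)"
  using assms by auto

lemma prologue1_mem:
  assumes "M 0 = int n" "n \<ge> 1" and M1: "M1 = fold exec_mem prologue1 M"
  shows "M1 0 = 64 * int n + 80" "M1 1 = 16" "M1 2 = 6" "M1 3 = 1" "M1 4 = 8 * int n"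
    "\<And>i. i < 5 \<Longrightarrow> M1 (64 * n + 16 * i) = M (i + 1)"
    "\<And>z. 6 \<le> z \<Longrightarrow> z < 64 * n \<Longrightarrow> M1 z = M z"
proof -
  define d where "d = 64 * n"
  have d: "d \<ge> 64" "int d = 64 * int n" using assms(2) by (simp_all add: d_def)
  define X1 where "X1 = M(0 := int d)"
  define X2 where "X2 = X1(d := X1 1, 1 := 16, 0 := int (d + 16))"
  define X3 where "X3 = X2(d + 16 := X2 2, 0 := int (d + 32))"
  define X4 where "X4 = X3(d + 32 := X3 3, 0 := int (d + 48))"
  define X5 where "X5 = X4(d + 48 := X4 4, 0 := int (d + 64))"
  define X6 where "X6 = X5(d + 64 := X5 5, 0 := int (d + 80))"
  have p: "prologue1 = [Add 0 0 0, Add 0 0 0, Add 0 0 0, Add 0 0 0, Add 0 0 0, Add 0 0 0] @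
      [Store 1 0, Const 1 16, Add 0 0 1] @ [Store 2 0, Add 0 0 1] @ [Store 3 0, Add 0 0 1] @
      [Store 4 0, Add 0 0 1] @ [Store 5 0, Add 0 0 1] @
      [Const 5 80, Sub 4 0 5, Half 4 4, Half 4 4, Half 4 4, Const 2 6, Const 3 1]"
    by (simp add: prologue1_def)
  have 1: "fold exec_mem [Add 0 0 0, Add 0 0 0, Add 0 0 0, Add 0 0 0, Add 0 0 0, Add 0 0 0] M = X1"
    using assms(1) d(2) by (simp add: X1_def)
  have 2: "fold exec_mem [Store 1 0, Const 1 16, Add 0 0 1] X1 = X2"
    using d(1) by (auto simp: X2_def X1_def fun_eq_iff)
  have one: "X2 1 = 16" "X3 1 = 16" "X4 1 = 16" "X5 1 = 16"
    using d(1) by (simp_all add: X2_def X3_def X4_def X5_def)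
  have 3: "fold exec_mem [Store 2 0, Add 0 0 1] X2 = X3"
    using d(1) one by (subst save_cell[of _ "d + 16"]) (simp_all add: X2_def X3_def add.commute)
  have 4: "fold exec_mem [Store 3 0, Add 0 0 1] X3 = X4"
    using d(1) one by (subst save_cell[of _ "d + 32"]) (simp_all add: X3_def X4_def add.commute)
  have 5: "fold exec_mem [Store 4 0, Add 0 0 1] X4 = X5"
    using d(1) one by (subst save_cell[of _ "d + 48"]) (simp_all add: X4_def X5_def add.commute)
  have 6: "fold exec_mem [Store 5 0, Add 0 0 1] X5 = X6"
    using d(1) one by (subst save_cell[of _ "d + 64"]) (simp_all add: X5_def X6_def add.commute)
  have "M1 = X6(5 := 80, 4 := 8 * int n, 2 := 6, 3 := 1)"
    unfolding M1 p fold_append comp_apply 1 2 3 4 5 6 using d(2)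
    by (simp add: X6_def)
  moreover have "X6 = M(1 := 16, 0 := int (d + 80), d := M 1, d + 16 := M 2, d + 32 := M 3,
      d + 48 := M 4, d + 64 := M 5)"
    using d(1) by (simp add: X6_def X5_def X4_def X3_def X2_def X1_def fun_eq_iff)
  ultimately have M1: "M1 = M(1 := 16, 0 := int (d + 80), d := M 1, d + 16 := M 2, d + 32 := M 3,
      d + 48 := M 4, d + 64 := M 5, 5 := 80, 4 := 8 * int n, 2 := 6, 3 := 1)" by simp
  show "M1 0 = 64 * int n + 80" "M1 1 = 16" "M1 2 = 6" "M1 3 = 1" "M1 4 = 8 * int n"
    unfolding M1 using d by simp_all
  show "M1 (64 * n + 16 * i) = M (i + 1)" if "i < 5" for i
  proof -
    have "i \<in> {0, 1, 2, 3, 4}" using that by auto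
    then show ?thesis unfolding M1 d_def[symmetric] using d(1) by (auto simp: numeral_2_eq_2[symmetric])
  qed
  show "M1 z = M z" if "6 \<le> z" "z < 64 * n" for z
    unfolding M1 using that d_def by simp
qed

lemma prologue_run:
  assumes P: "code_at P 0 prologue" and M: "M 0 = int n" and n: "n \<ge> 1"
  shows "\<exists>j M'. j \<le> 100 * n \<and> run P j (0, M) = (41, M') \<and> M' 60 = 64 * int n \<and>
    M' 10 = int n \<and> (\<forall>i<4 * n. M' (64 * n + 16 * i) = M (i + 1))"
proof -
  define M1 where "M1 = fold exec_mem prologue1 M"
  note m1 = prologue1_mem[OF M n M1_def]
  have l1: "length prologue1 = 24" and st1: "\<forall>i \<in> set prologue1. straight i"
    by (simp_all add: prologue1_def)
  have l2: "length prologue2 = 8" and st2: "\<forall>i \<in> set prologue2. straight i"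
    by (simp_all add: prologue2_def)
  have lc: "length (copy_code 24) = 9" by (simp add: copy_code_def)
  have P: "code_at P 0 prologue1" "code_at P 24 (copy_code 24)" "code_at P 33 prologue2"
    using P unfolding prologue_def code_at_append l1 lc by simp_all
  have r1: "run P 24 (0, M) = (24, M1)"
    using run_straight[OF P(1) st1, of M] by (simp add: l1 M1_def)
  have "\<exists>M2. run P (8 * (8 * n) + 2) (24, M1) = (24 + 9, M2) \<and>
    M2 0 = 64 * int n + 80 + int (8 * n) * 16 \<and> M2 2 = 6 + int (8 * n) * 1 \<and>
    (\<forall>i<8 * n. M2 (nat (64 * int n + 80 + int i * 16)) = M1 (nat (6 + int i * 1))) \<and>
    (\<forall>z\<ge>6. (\<forall>i<8 * n. z \<noteq> nat (64 * int n + 80 + int i * 16)) \<longrightarrow> M2 z = M1 z)"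
    by (rule copy_code_run[OF P(2)]) (use m1 n in auto)
  then obtain M2 where M2: "run P (8 * (8 * n) + 2) (24, M1) = (33, M2)" "M2 2 = 6 + 8 * int n"
    "\<And>i. i < 8 * n \<Longrightarrow> M2 (nat (64 * int n + 80 + int i * 16)) = M1 (nat (6 + int i * 1))"
    "\<And>z. z \<ge> 6 \<Longrightarrow> \<forall>i<8 * n. z \<noteq> nat (64 * int n + 80 + int i * 16) \<Longrightarrow> M2 z = M1 z"
    by auto
  define M3 where "M3 = fold exec_mem prologue2 M2"
  have r3: "run P 8 (33, M2) = (41, M3)"
    using run_straight[OF P(3) st2, of M2] by (simp add: l2 M3_def)
  have M3: "M3 = M2(5 := 6, 10 := int n, 60 := 64 * int n)"
    using M2(2) by (simp add: M3_def prologue2_def fun_eq_iff)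
  have "M3 (64 * n + 16 * i) = M (i + 1)" if i: "i < 4 * n" for i
  proof -
    have "M3 (64 * n + 16 * i) = M2 (64 * n + 16 * i)" using n by (simp add: M3)
    also have "\<dots> = M (i + 1)"
    proof (cases "i < 5")
      case True
      have "M2 (64 * n + 16 * i) = M1 (64 * n + 16 * i)"
        using True n by (intro M2(4)) auto
      then show ?thesis using m1(6)[OF True] by simp
    next
      case False
      then obtain k where k: "i = k + 5" by (metis add.commute le_Suc_ex not_less)
      have "nat (64 * int n + 80 + int k * 16) = 64 * n + 16 * i" "nat (6 + int k * 1) = i + 1"
        using k by auto
      then show ?thesis using M2(3)[of k] m1(7)[of "i + 1"] i k by simp
    qed
    finally show ?thesis .
  qed
  moreover have "run P (24 + (8 * (8 * n) + 2) + 8) (0, M) = (41, M3)"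
    by (rule run_trans[OF run_trans[OF r1 M2(1)] r3])
  moreover have "24 + (8 * (8 * n) + 2) + 8 \<le> 100 * n" using n by simp
  moreover have "M3 60 = 64 * int n" "M3 10 = int n" by (simp_all add: M3)
  ultimately show ?thesis by blast
qed

text \<open>The last register to be overwritten is the pointer in cell 0. Doubling it needs no second
  register, so the label of agent 0 is first moved to twice the address of the label of agent 1.\<close>

definition epilogue1 :: "instr list" where
  "epilogue1 = [Const 0 11, Add 0 0 60, Load 5 0, Const 1 16, Add 0 0 1, Add 0 0 0, Store 5 0,
     Const 1 5, Add 0 10 1, Add 2 0 0, Add 2 2 2, Add 2 2 2, Add 2 2 2, Add 2 2 60, Const 1 11,
     Add 2 2 1, Const 1 0, Add 4 10 1, Const 1 (-1), Const 3 (-16)]"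

definition epilogue2 :: "instr list" where
  "epilogue2 = [Const 0 0, Add 0 0 2, Const 1 16, Load 5 0, Sub 0 0 1, Load 4 0, Sub 0 0 1,
     Load 3 0, Sub 0 0 1, Load 2 0, Sub 0 0 1, Load 1 0, Add 0 0 0, Load 0 0]"

definition epilogue :: "nat \<Rightarrow> instr list" where
  "epilogue q = epilogue1 @ copy_code (q + 20) @ epilogue2"

lemma length_epilogue: "length (epilogue q) = 43"
  by (simp add: epilogue_def epilogue1_def copy_code_def epilogue2_def)

text \<open>\<open>80 * n + 91\<close> is the address \<open>64 * n + 16 * (n + 5) + 11\<close> of
  entry \<open>n + 5\<close> of the label array, from which \<open>n\<close> downward steps lead to
  entry 5 whatever \<open>n\<close> is. The surplus entries land in cells from \<open>n\<close> on,
  outside the output. \<open>128 * n + 54\<close> is twice the address of the label of agent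
  1.\<close>

lemma epilogue1_mem:
  assumes "M 60 = 64 * int n" "M 10 = int n" "n \<ge> 1" and M1: "M1 = fold exec_mem epilogue1 M"
  shows "M1 0 = int n + 5" "M1 1 = - 1" "M1 2 = 80 * int n + 91" "M1 3 = - 16" "M1 4 = int n"
    "M1 (128 * n + 54) = M (64 * n + 11)"
    "\<And>z. z \<ge> 6 \<Longrightarrow> z \<noteq> 128 * n + 54 \<Longrightarrow> M1 z = M z"
proof -
  define d where "d = 64 * n"
  have d: "d \<ge> 64" "M 60 = int d" using assms by (simp_all add: d_def)
  define X where "X = M(0 := int (2 * d + 54), 1 := 16, 5 := M (d + 11), 2 * d + 54 := M (d + 11))"
  have p: "epilogue1 = [Const 0 11, Add 0 0 60] @ [Load 5 0, Const 1 16, Add 0 0 1, Add 0 0 0] @ [Store 5 0] @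
     [Const 1 5, Add 0 10 1, Add 2 0 0, Add 2 2 2, Add 2 2 2, Add 2 2 2, Add 2 2 60, Const 1 11,
     Add 2 2 1, Const 1 0, Add 4 10 1, Const 1 (-1), Const 3 (-16)]"
    by (simp add: epilogue1_def)
  have 1: "fold exec_mem [Const 0 11, Add 0 0 60] M = M(0 := int (d + 11))"
    using d by (simp add: add.commute)
  have 2: "fold exec_mem [Load 5 0, Const 1 16, Add 0 0 1, Add 0 0 0] (M(0 := int (d + 11))) =
      M(0 := int (2 * d + 54), 1 := 16, 5 := M (d + 11))"
  proof -
    have "nat (int d + 11) = d + 11" by simp
    then show ?thesis by (auto simp: fun_eq_iff)
  qed
  have 3: "fold exec_mem [Store 5 0] (M(0 := int (2 * d + 54), 1 := 16, 5 := M (d + 11))) = X"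
    by (simp add: X_def del: of_nat_add of_nat_mult)
  have X: "X 60 = 64 * int n" "X 10 = int n" using d(1) assms by (simp_all add: X_def)
  have "M1 = X(0 := int n + 5, 2 := 80 * int n + 91, 4 := int n, 1 := - 1, 3 := - 16)"
    unfolding M1 p fold_append comp_apply 1 2 3 using X by (simp add: fun_eq_iff)
  then show "M1 0 = int n + 5" "M1 1 = - 1" "M1 2 = 80 * int n + 91" "M1 3 = - 16" "M1 4 = int n"
    "M1 (128 * n + 54) = M (64 * n + 11)"
    "\<And>z. z \<ge> 6 \<Longrightarrow> z \<noteq> 128 * n + 54 \<Longrightarrow> M1 z = M z"
    by (simp_all add: X_def d_def)
qed

lemma epilogue2_mem:
  assumes "M 2 = int d + 91" "d \<ge> 64" and M1: "M1 = fold exec_mem epilogue2 M"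
  shows "M1 0 = M (2 * d + 54)" "M1 1 = M (d + 27)" "M1 2 = M (d + 43)" "M1 3 = M (d + 59)"
    "M1 4 = M (d + 75)" "M1 5 = M (d + 91)" "\<And>z. z \<ge> 6 \<Longrightarrow> M1 z = M z"
proof -
  have load: "fold exec_mem [Load j 0, Sub 0 0 1] X = X(j := X (e + 16), 0 := int e)"
    if "X 0 = int (e + 16)" "X 1 = 16" "j \<ge> 2" for j X e
    using that by (auto simp: fun_eq_iff nat_add_distrib)
  have p: "epilogue2 = [Const 0 0, Add 0 0 2, Const 1 16] @ [Load 5 0, Sub 0 0 1] @
     [Load 4 0, Sub 0 0 1] @ [Load 3 0, Sub 0 0 1] @ [Load 2 0, Sub 0 0 1] @
     [Load 1 0, Add 0 0 0] @ [Load 0 0]"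
    by (simp add: epilogue2_def)
  define X1 where "X1 = M(0 := int (d + 75 + 16), 1 := 16)"
  define X2 where "X2 = X1(5 := X1 (d + 75 + 16), 0 := int (d + 59 + 16))"
  define X3 where "X3 = X2(4 := X2 (d + 59 + 16), 0 := int (d + 43 + 16))"
  define X4 where "X4 = X3(3 := X3 (d + 43 + 16), 0 := int (d + 27 + 16))"
  define X5 where "X5 = X4(2 := X4 (d + 27 + 16), 0 := int (d + 27))"
  define X6 where "X6 = X5(1 := X5 (d + 27), 0 := int (2 * d + 54))"
  have 1: "fold exec_mem [Const 0 0, Add 0 0 2, Const 1 16] M = X1"
    using assms(1) by (simp add: X1_def fun_eq_iff)
  have 2: "fold exec_mem [Load 5 0, Sub 0 0 1] X1 = X2"
    by (subst load[of _ "d + 75"]) (simp_all add: add.commute X1_def X2_def)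
  have 3: "fold exec_mem [Load 4 0, Sub 0 0 1] X2 = X3"
    by (subst load[of _ "d + 59"]) (simp_all add: add.commute X1_def X2_def X3_def)
  have 4: "fold exec_mem [Load 3 0, Sub 0 0 1] X3 = X4"
    by (subst load[of _ "d + 43"]) (simp_all add: add.commute X1_def X2_def X3_def X4_def)
  have 5: "fold exec_mem [Load 2 0, Sub 0 0 1] X4 = X5"
    by (subst load[of _ "d + 27"]) (simp_all add: add.commute X1_def X2_def X3_def X4_def X5_def)
  have 6: "fold exec_mem [Load 1 0, Add 0 0 0] X5 = X6"
  proof -
    have "X5 0 = int (d + 27)" by (simp add: X5_def)
    then show ?thesis by (simp add: X6_def del: of_nat_add of_nat_mult) simp
  qed
  have "X6 0 = int (2 * d + 54)" by (simp add: X6_def)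
  then have "M1 = X6(0 := X6 (2 * d + 54))"
    unfolding M1 p fold_append comp_apply 1 2 3 4 5 6 by (simp del: of_nat_add of_nat_mult)
  moreover have "X6 = M(5 := M (d + 91), 4 := M (d + 75), 3 := M (d + 59), 2 := M (d + 43),
      1 := M (d + 27), 0 := int (2 * d + 54))"
    using assms(2) by (simp add: X6_def X5_def X4_def X3_def X2_def X1_def fun_eq_iff add.commute)
  ultimately show "M1 0 = M (2 * d + 54)" "M1 1 = M (d + 27)" "M1 2 = M (d + 43)" "M1 3 = M (d + 59)"
    "M1 4 = M (d + 75)" "M1 5 = M (d + 91)" "\<And>z. z \<ge> 6 \<Longrightarrow> M1 z = M z"
    using assms(2) by simp_all
qed

lemma epilogue_run:
  assumes P: "code_at P q (epilogue q)" and M: "M 60 = 64 * int n" "M 10 = int n" and n: "n \<ge> 1"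
  shows "\<exists>j M'. j \<le> 100 * n \<and> run P j (q, M) = (q + 43, M') \<and>
    (\<forall>i<n. M' i = M (64 * n + 16 * i + 11))"
proof -
  define M1 where "M1 = fold exec_mem epilogue1 M"
  note m1 = epilogue1_mem[OF M n M1_def]
  have l1: "length epilogue1 = 20" and st1: "\<forall>i \<in> set epilogue1. straight i"
    by (simp_all add: epilogue1_def)
  have l2: "length epilogue2 = 14" and st2: "\<forall>i \<in> set epilogue2. straight i"
    by (simp_all add: epilogue2_def)
  have lc: "length (copy_code (q + 20)) = 9" by (simp add: copy_code_def)
  have P: "code_at P q epilogue1" "code_at P (q + 20) (copy_code (q + 20))"
    "code_at P (q + 20 + 9) epilogue2"
    using P unfolding epilogue_def code_at_append l1 lc by simp_all
  have r1: "run P 20 (q, M) = (q + 20, M1)"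
    using run_straight[OF P(1) st1, of M] by (simp add: l1 M1_def)
  have "\<exists>M2. run P (8 * n + 2) (q + 20, M1) = (q + 20 + 9, M2) \<and>
    M2 0 = int n + 5 + int n * (- 1) \<and> M2 2 = 80 * int n + 91 + int n * (- 16) \<and>
    (\<forall>i<n. M2 (nat (int n + 5 + int i * (- 1))) = M1 (nat (80 * int n + 91 + int i * (- 16)))) \<and>
    (\<forall>z\<ge>6. (\<forall>i<n. z \<noteq> nat (int n + 5 + int i * (- 1))) \<longrightarrow> M2 z = M1 z)"
    by (rule copy_code_run[OF P(2)]) (use m1 n in auto)
  then obtain M2 where M2: "run P (8 * n + 2) (q + 20, M1) = (q + 20 + 9, M2)"
    "M2 2 = int (64 * n) + 91"
    "\<And>i. i < n \<Longrightarrow> M2 (nat (int n + 5 + int i * (- 1))) = M1 (nat (80 * int n + 91 + int i * (- 16)))"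
    "\<And>z. z \<ge> 6 \<Longrightarrow> \<forall>i<n. z \<noteq> nat (int n + 5 + int i * (- 1)) \<Longrightarrow> M2 z = M1 z"
    by auto
  have high: "M2 z = M1 z" if "z \<ge> 64 * n" for z
    using that n by (intro M2(4)) auto
  define M3 where "M3 = fold exec_mem epilogue2 M2"
  have "64 * n \<ge> 64" using n by simp
  note m3 = epilogue2_mem[OF M2(2) this M3_def]
  have r3: "run P 14 (q + 20 + 9, M2) = (q + 43, M3)"
    using run_straight[OF P(3) st2, of M2] by (simp add: l2 M3_def)
  \<comment> \<open>Label addresses are odd, while the cell that keeps the label of agent 0 is even,
    so the two never meet.\<close>
  have odd: "64 * n + 16 * i + 11 \<noteq> 128 * n + 54" for i
  proof
    assume "64 * n + 16 * i + 11 = 128 * n + 54"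
    then have "even (64 * n + 16 * i + 11)" by simp
    then show False by simp
  qed
  have "M3 i = M (64 * n + 16 * i + 11)" if i: "i < n" for i
  proof (cases "i \<ge> 6")
    case True
    \<comment> \<open>Copying runs downwards from cell \<open>n + 5\<close>, so cell
      \<open>i\<close> is written in round \<open>n + 5 - i\<close>, counted from 0.\<close>
    define k where "k = n + 5 - i"
    have k: "k < n" "nat (int n + 5 + int k * (- 1)) = i"
      "nat (80 * int n + 91 + int k * (- 16)) = 64 * n + 16 * i + 11"
      using True i by (auto simp: k_def of_nat_diff)
    have "M3 i = M2 i" using m3(7) True by simp
    also have "\<dots> = M1 (64 * n + 16 * i + 11)" using M2(3)[OF k(1)] k(2,3) by simp
    also have "\<dots> = M (64 * n + 16 * i + 11)" using odd by (intro m1(7)) auto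
    finally show ?thesis .
  next
    case False
    have "M2 (64 * n + 16 * i + 11) = M (64 * n + 16 * i + 11)" for i
      using high[of "64 * n + 16 * i + 11"] m1(7)[of "64 * n + 16 * i + 11"] odd by simp
    from this[of 1] this[of 2] this[of 3] this[of 4] this[of 5]
    have v: "M2 (64 * n + 27) = M (64 * n + 27)" "M2 (64 * n + 43) = M (64 * n + 43)"
      "M2 (64 * n + 59) = M (64 * n + 59)" "M2 (64 * n + 75) = M (64 * n + 75)"
      "M2 (64 * n + 91) = M (64 * n + 91)" by (simp_all add: add.commute)
    have "M2 (2 * (64 * n) + 54) = M (64 * n + 11)"
      using high[of "2 * (64 * n) + 54"] m1(6) by simp
    moreover have "i = 0 \<or> i = 1 \<or> i = 2 \<or> i = 3 \<or> i = 4 \<or> i = 5" using False by linarith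
    ultimately show ?thesis using m3(1-6) v by (elim disjE) (simp_all add: add.commute)
  qed
  moreover have "run P (20 + (8 * n + 2) + 14) (q, M) = (q + 43, M3)"
    by (rule run_trans[OF run_trans[OF r1 M2(1)] r3])
  moreover have "20 + (8 * n + 2) + 14 \<le> 100 * n" using n by simp
  ultimately show ?thesis by blast
qed

lemma utility_cong:
  assumes "\<And>v. v < n \<Longrightarrow> l v = l' v" "u < n"
  shows "utility n es l u = utility n es l' u"
proof -
  have "coalition n l u = coalition n l' u" using assms by (auto simp: coalition_def)
  then show ?thesis by (simp add: utility_def)
qed

lemma max_egalitarian_cong:
  assumes "\<And>v. v < n \<Longrightarrow> l v = l' v" "max_egalitarian n es l"
  shows "max_egalitarian n es l'"
proof -
  have "utility n es l ` {0..<n} = utility n es l' ` {0..<n}"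
    using utility_cong[of n l l'] assms(1) by (intro image_cong) auto
  then show ?thesis using assms(2) by (simp add: max_egalitarian_def egal_welfare_def)
qed

lemma input_mem_edge:
  assumes "i < length es" "es ! i = (u, w, a, b)" "r < 4"
  shows "input_mem n es (4 * i + r + 1) = [int u, int w, a, b] ! r"
proof -
  have "(4 * i + r + 1 - 1) div 4 = i" "(4 * i + r + 1 - 1) mod 4 = r"
    using assms(3) by simp_all
  moreover have "4 * i + r + 1 \<le> 4 * length es" using assms(1,3) by linarith
  ultimately show ?thesis using assms(2) unfolding input_mem_def by simp
qed

section \<open>The complete program and its running time\<close>

definition program :: "instr list" where
  "program = prologue @ comp 41 main @ epilogue (41 + csize main)"

lemma program_run:
  assumes tree: "is_tree_game n es" and W: "Wmax n es < 2 ^ L"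
  shows "\<exists>k. k \<le> 40000 * n * (L + 1) \<and> halted program (run program k (0, input_mem n es)) \<and>
    max_egalitarian n es (snd (run program k (0, input_mem n es)))"
proof -
  have n: "n \<ge> 1" "length es = n - 1" using tree by (auto simp: is_tree_game_def)
  have len: "length program = 41 + csize main + 43"
    by (simp add: program_def length_prologue length_epilogue)
  have P: "code_at program 0 prologue" "code_at program 41 (comp 41 main)"
    "code_at program (41 + csize main) (epilogue (41 + csize main))"
    using code_at_self[of "[]" prologue] code_at_self[of prologue "comp 41 main"]
      code_at_self[of "prologue @ comp 41 main" _ "[]"]
    by (simp_all add: program_def length_prologue)
  have "input_mem n es 0 = int n" by (simp add: input_mem_def)
  then obtain j1 M1 where 1: "j1 \<le> 100 * n" "run program j1 (0, input_mem n es) = (41, M1)"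
    "M1 60 = 64 * int n" "M1 10 = int n" "\<forall>i<4 * n. M1 (64 * n + 16 * i) = input_mem n es (i + 1)"
    using prologue_run[OF P(1) _ n(1)] by blast
  define A where "A a i = M1 (64 * n + 16 * i + a)" for a i
  \<comment> \<open>The memory itself serves as the abstract register file. Leftovers of the copy
    loop are harmless because \<open>main_spec\<close> constrains only register 10.\<close>
  have rep: "rep n M1 (M1, A)" using 1(3) by (simp add: rep_def A_def)
  have "input_array es A"
    unfolding input_array_def
  proof (intro allI impI)
    fix i u w a b assume i: "i < length es" "es ! i = (u, w, a, b)"
    have "A 0 (4 * i + r) = [int u, int w, a, b] ! r" if "r < 4" for r
    proof -
      have "4 * i + r < 4 * n" using i(1) n that by linarith
      then show ?thesis
        using 1(5)[rule_format, of "4 * i + r"] input_mem_edge[OF i that, of n] by (simp add: A_def)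
    qed
    from this[of 0] this[of 1] this[of 2] this[of 3]
    show "A 0 (4 * i) = int u \<and> A 0 (4 * i + 1) = int w \<and> A 0 (4 * i + 2) = a \<and> A 0 (4 * i + 3) = b"
      by simp
  qed
  then have "wpt main (3000 * n * (L + 1)) (\<lambda>(R', A'). R' 10 = int n \<and> max_egalitarian n es (A' 11)) (M1, A)"
    by (intro main_spec tree W 1(4))
  then obtain R2 A2 k where 2: "bs main (M1, A) k (R2, A2)" "k \<le> 3000 * n * (L + 1)"
    "R2 10 = int n" "max_egalitarian n es (A2 11)"
    unfolding wpt_def by auto
  obtain j2 M2 where 3: "j2 \<le> 11 * k" "run program j2 (41, M1) = (41 + csize main, M2)"
    "rep n M2 (R2, A2)"
    using comp_correct[OF 2(1) wf_main n(1) rep P(2)] by blast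
  have "M2 60 = 64 * int n" "M2 10 = int n" using 3(3) 2(3) by (simp_all add: rep_def)
  then obtain j3 M3 where 4: "j3 \<le> 100 * n"
    "run program j3 (41 + csize main, M2) = (41 + csize main + 43, M3)"
    "\<forall>i<n. M3 i = M2 (64 * n + 16 * i + 11)"
    using epilogue_run[OF P(3) _ _ n(1)] by blast
  have run: "run program (j1 + j2 + j3) (0, input_mem n es) = (41 + csize main + 43, M3)"
    by (rule run_trans[OF run_trans[OF 1(2) 3(2)] 4(2)])
  have "max_egalitarian n es M3"
    by (rule max_egalitarian_cong[OF _ 2(4)]) (use 3(3) 4(3) in \<open>simp add: rep_def\<close>)
  \<comment> \<open>Eleven instructions per unit of cost make 33000 out of 3000, and 200 more pay
    for moving the data.\<close>
  moreover have "j1 + j2 + j3 \<le> 100 * n + 11 * (3000 * n * (L + 1)) + 100 * n"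
    using 1(1) 2(2) 3(1) 4(1) by linarith
  then have "j1 + j2 + j3 \<le> 40000 * n * (L + 1)"
    by (rule le_trans) (simp add: algebra_simps)
  ultimately show ?thesis
    using run by (intro exI[of _ "j1 + j2 + j3"]) (simp add: halted_def len)
qed

lemma Wmax_nonneg:
  assumes "n \<ge> 1"
  shows "Wmax n es \<ge> 0"
proof -
  have "0 \<le> (\<Sum>v \<in> nbrs es 0. \<bar>wt es 0 v\<bar>)" by (intro sum_nonneg) auto
  also have "\<dots> \<le> Wmax n es" unfolding Wmax_def using assms by (intro Max_ge) auto
  finally show ?thesis .
qed

theorem theorem9:
  "\<exists>(P :: instr list) (c :: real). c > 0 \<and>
     (\<forall>n es. is_tree_game n es \<longrightarrow>
        (\<exists>k. real k \<le> c * real n * log 2 (real_of_int (Wmax n es) + 2)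
             \<and> halted P (run P k (0, input_mem n es))
             \<and> max_egalitarian n es (snd (run P k (0, input_mem n es)))))"
proof (intro exI[of _ program] exI[of _ "120000::real"] conjI allI impI)
  fix n es assume tree: "is_tree_game n es"
  define W where "W = real_of_int (Wmax n es) + 2"
  have W: "W \<ge> 2"
    using Wmax_nonneg[of n es] tree by (simp add: W_def is_tree_game_def)
  define L where "L = nat \<lfloor>log 2 W\<rfloor> + 1"
  \<comment> \<open>The summand 2 in \<open>W\<close> keeps the logarithm at least 1 even if all
    valuations vanish, so that it can absorb additive constants.\<close>
  have log: "log 2 W \<ge> 1" using W by simp
  then have L: "log 2 W < real L" "real L \<le> log 2 W + 1" unfolding L_def by linarith+
  have "W < 2 ^ L" using L(1) W by (simp add: log_less_iff powr_realpow)
  then have "real_of_int (Wmax n es) < 2 ^ L" unfolding W_def by linarith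
  then have "Wmax n es < 2 ^ L" by simp
  then obtain k where k: "k \<le> 40000 * n * (L + 1)"
    "halted program (run program k (0, input_mem n es))"
    "max_egalitarian n es (snd (run program k (0, input_mem n es)))"
    using program_run[OF tree] by blast
  have "real k \<le> real (40000 * n * (L + 1))" using k(1) by (simp only: of_nat_le_iff)
  also have "\<dots> = 40000 * real n * (real L + 1)" by (simp add: algebra_simps)
  \<comment> \<open>\<open>L + 1\<close> is at most \<open>log 2 W + 2\<close>, hence at most three
    logarithms; this is the factor from 40000 to 120000.\<close>
  also have "\<dots> \<le> 40000 * real n * (3 * log 2 W)"
    using L(2) log by (intro mult_left_mono) auto
  finally have "real k \<le> 120000 * real n * log 2 W" by simp
  then show "\<exists>k. real k \<le> 120000 * real n * log 2 (real_of_int (Wmax n es) + 2)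
      \<and> halted program (run program k (0, input_mem n es))
      \<and> max_egalitarian n es (snd (run program k (0, input_mem n es)))"
    using k(2,3) unfolding W_def by blast
qed simp

end
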